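(* Assume $N=2$, $U(v)=\log v$, and that the rate matrix $A$ is homogeneous, $a_{i,j}(t)=a_{i,j}$. Let $i\in\{1,2\}$. (a) The functions $K(t,1),K(t,2)$ solving $K_t(t,i)+\zeta_i-a_{i,i}K(t,3-i)+a_{i,i}K(t,i)=0$, $K(R,i)=0$, are given by $$K(t,i)=\frac{1}{(a_{1,1}+a_{2,2})^2}\Big[\zeta_{3-i}\,a_{i,i}\left(1-e^{(a_{1,1}+a_{2,2})(R-t)}+(a_{1,1}+a_{2,2})(R-t)\right)$$ $$+\zeta_i\left(a_{3-i,3-i}^2(R-t)+a_{i,i}\left(e^{(a_{1,1}+a_{2,2})(R-t)}-1+a_{3-i,3-i}(R-t)\right)\right)\Big].$$ (b) The optimal feedback bond fractions $\widetilde\pi^P_1(t),\widetilde\pi^P_2(t)$ are given by $$\widetilde\pi^P_i(t)=\begin{cases}-\dfrac{h_i+a_{i,i}\widetilde\psi_i(t)}{(h_i-a_{i,i})\widetilde\psi_i(t)},&\text{if }\theta_i(t)=0,\\[2ex]\dfrac{(a_{i,i}-h_i)\widetilde\psi_i(t)+\theta_i(t)(\widetilde\psi_i(t)-1)+\sqrt{\Delta_i(t)}}{2\theta_i(t)\widetilde\psi_i(t)},&\text{if }\theta_i(t)\ne0.\end{cases}$$ (c) The functions $J(t,1),J(t,2)$ solving $$J_t(t,i)+\zeta_i+\widetilde\pi^P_i(t)\theta_i(t)+h_i\left(\log(1-\widetilde\pi^P_i(t))+K(t,i)-J(t,i)\right)-a_{i,i}\left[\log\left(1+\widetilde\pi^P_i(t)\widetilde\psi_i(t)\right)+J(t,3-i)-J(t,i)\right]=0,$$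 $J(R,i)=0$, are given by $$J(t,i)=\frac{1}{2c_+}e^{\frac{t(c_1+c_2)}{2}}\Big[\Big(-\sqrt{c_+}\cosh\big(\tfrac{t\sqrt{c_+}}2\big)+(c_2-c_1)\sinh\big(\tfrac{t\sqrt{c_+}}2\big)\Big)\,I_i(t)-2(h_i-c_i)\sinh\big(\tfrac{t\sqrt{c_+}}2\big)\,\tilde I_i(t)\Big],$$ where $$I_i(t)=\int_t^Re^{-\frac{s(\sqrt{c_+}+c_1+c_2)}2}\Big(2(e^{s\sqrt{c_+}}-1)(h_i-c_i)(\zeta_{3-i}+g_{3-i}(s))$$ $$+\big((3-2i)(c_2-c_1)-\sqrt{c_+}-e^{s\sqrt{c_+}}((3-2i)(c_2-c_1)+\sqrt{c_+})\big)(\zeta_i+g_i(s))\Big)ds,$$ $$\tilde I_i(t)=\int_t^Re^{-\frac{s(\sqrt{c_+}+c_1+c_2)}2}\Big(\big(-\sqrt{c_+}+e^{s\sqrt{c_+}}[(3-2i)(c_2-c_1)-\sqrt{c_+}]-(3-2i)(c_2-c_1)\big)(\zeta_{3-i}+g_{3-i}(s))$$ $$+2(e^{s\sqrt{c_+}}-1)(h_{3-i}-c_{3-i})(\zeta_i+g_i(s))\Big)ds.$$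
   Context: Setting. $X$ is a two-state continuous-time Markov process with states $e_1,e_2$ (canonical basis of $\mathbb R^2$) and constant generator $A=[a_{i,j}]_{i,j=1,2}$ under the historical measure $\mathbb P$, so $a_{i,3-i}=-a_{i,i}$. For each regime $i$: $r_i>0$, $\mu_i$, $\sigma_i$, $h_i>0$, $L_i\in\mathbb R$ are constants (short rate, stock drift, stock volatility, default intensity, loss rate), and $\eta_i=(\mu_i-r_i)/\sigma_i$. Under an equivalent pricing measure $\mathbb Q$, $X$ is Markov with generator $[a^{\mathbb Q}_{i,j}(t)]$, where $a^{\mathbb Q}_{i,j}$ is continuous on $[0,T]$, $a^{\mathbb Q}_{i,3-i}=a_{i,3-i}(1+\kappa_{i,3-i})$ with $\kappa_{i,3-i}>-1$ bounded measurable, and $a^{\mathbb Q}_{i,i}=-a^{\mathbb Q}_{i,3-i}$. $T$ is the bond maturity and $R\le T$ the investment horizon. With $r_s,h_s,L_s$ equal to $r_i,h_i,L_i$ when $X_s=e_i$, $$\psi_i(t)=\mathbb E^{\mathbb Q}\left[e^{-\int_t^T(r_s+h_sL_s)ds}\,\middle|\,X_t=e_i\right],\qquad \theta_i(t)=h_iL_i-a^{\mathbb Q}_{i,3-i}(t)\left(\frac{\psi_{3-i}(t)}{\psi_i(t)}-1\right).$$ An investor with utility $U(v)=\log v$ of wealth at time $R$ trades a money market account, a stock and a defaultable bond in this market. Optimal feedback bond fraction: $\widetilde\pi^P_i(t)$, the optimal fraction of wealth held in the bond in regime $i$ before default, is the unique solution $p\in(M_i(t),1)$ of $$\theta_i(t)-\frac{h_i}{1-p}-a_{i,i}\frac{\psi_{3-i}(t)-\psi_i(t)}{\psi_i(t)+p(\psi_{3-i}(t)-\psi_i(t))}=0,$$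 where $M_i(t)=-\frac{\psi_i(t)}{\psi_{3-i}(t)-\psi_i(t)}$ if $\psi_i(t)<\psi_{3-i}(t)$ and $M_i(t)=-\infty$ otherwise. (The optimal post-default and pre-default value functions are $\log v+K(t,i)$ and $\log v+J(t,i)$, respectively.) Notation, for $i=1,2$: $\zeta_i=r_i+\eta_i^2/2$; $\ \widetilde\psi_1(t)=\frac{\psi_2(t)}{\psi_1(t)}-1$; $\ \widetilde\psi_2(t)=\frac{\psi_1(t)}{\psi_2(t)}-1$; $\ c_1=h_1-a_{1,1}$; $\ c_2=h_2-a_{2,2}$; $\ c_+=(c_2-c_1)^2+4a_{1,1}a_{2,2}$; $$g_i(t)=\widetilde\pi^P_i(t)\theta_i(t)+h_i\left(\log(1-\widetilde\pi^P_i(t))+K(t,i)\right)-a_{i,i}\log\left(1+\widetilde\pi^P_i(t)\widetilde\psi_i(t)\right),$$ $$\Delta_i(t)=-4\theta_i(t)\widetilde\psi_i(t)\left(h_i-\theta_i(t)+a_{i,i}\widetilde\psi_i(t)\right)+\left(\theta_i(t)-a_{i,i}\widetilde\psi_i(t)+h_i\widetilde\psi_i(t)-\theta_i(t)\widetilde\psi_i(t)\right)^2.$$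
   Formalization: In (c) the factor c_2-c_1 before sinh multiplying I_i(t) is corrected to (3-2i)(c_2-c_1), since the printed formula fails for i=2; the formulas are claimed where defined: a_{1,1}+a_{2,2}≠0 in (a), ψ̃_i(t)≠0 in (b), c_+≠0 in (c). *)

theory Defs
  imports "HOL-Probability.Probability"
begin

text \<open>
  The two states \<open>e\<^sub>1, e\<^sub>2\<close> are encoded by the natural numbers \<open>1, 2\<close>; for \<open>i \<in> {1,2}\<close> the
  other state is \<open>3 - i\<close>.
\<close>

definition is_generator :: "(nat \<Rightarrow> nat \<Rightarrow> real) \<Rightarrow> bool" where
  "is_generator a \<longleftrightarrow> (\<forall>i\<in>{1,2}. 0 \<le> a i (3 - i) \<and> a i i = - a i (3 - i))"

definition cadlag_path :: "real \<Rightarrow> (real \<Rightarrow> nat) \<Rightarrow> bool" where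
  "cadlag_path T x \<longleftrightarrow>
     (\<forall>t\<in>{0..<T}. \<forall>\<^sub>F u in at_right t. x u = x t) \<and>
     (\<forall>t\<in>{0<..T}. \<exists>j. \<forall>\<^sub>F u in at_left t. x u = j)"

definition generated_events ::
  "'w measure \<Rightarrow> (real \<Rightarrow> 'w \<Rightarrow> nat) \<Rightarrow> real set \<Rightarrow> 'w set set" where
  "generated_events M X I =
     sigma_sets (space M) {X u -` {j} \<inter> space M | u j. u \<in> I \<and> j \<in> {1,2}}"

text \<open>
  A time-inhomogeneous two-state Markov process on \<open>[0,T]\<close> with generator \<open>G t\<close>, as a Markov family:
  \<open>Pr s i\<close> is the conditional law given \<open>X\<^sub>s = i\<close>. Working with the family rather than with
  elementary conditioning gives \<open>E[\<dots> | X\<^sub>s = i]\<close> its usual meaning also when the event \<open>X\<^sub>s = i\<close>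
  has probability \<open>0\<close> (for instance at \<open>s = 0\<close> with a deterministic initial state). Only the
  measurable space underlying \<open>M\<close> matters. The last clause is the Kolmogorov forward equation for
  the transition probabilities \<open>Pr s i (X\<^sub>t = j)\<close>; the derivative is one-sided at \<open>t = s\<close>
  and at \<open>t = T\<close>.
\<close>

definition markov_family ::
  "'w measure \<Rightarrow> real \<Rightarrow> (real \<Rightarrow> nat \<Rightarrow> 'w measure) \<Rightarrow> (real \<Rightarrow> 'w \<Rightarrow> nat)
     \<Rightarrow> (real \<Rightarrow> nat \<Rightarrow> nat \<Rightarrow> real) \<Rightarrow> bool" where
  "markov_family M T Pr X G \<longleftrightarrow>
     (\<forall>t\<in>{0..T}. X t \<in> M \<rightarrow>\<^sub>M count_space {1,2}) \<and>
     (\<forall>\<omega>\<in>space M. cadlag_path T (\<lambda>t. X t \<omega>)) \<and>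
     (\<forall>s\<in>{0..T}. \<forall>i\<in>{1,2}.
        prob_space (Pr s i) \<and> sets (Pr s i) = sets M \<and> (AE \<omega> in Pr s i. X s \<omega> = i)) \<and>
     (\<forall>s\<in>{0..T}. \<forall>t\<in>{s..T}. \<forall>i\<in>{1,2}. \<forall>j\<in>{1,2}.
        \<forall>A\<in>generated_events M X {s..t}. \<forall>B\<in>generated_events M X {t..T}.
          measure (Pr s i) (A \<inter> {\<omega>\<in>space M. X t \<omega> = j} \<inter> B) =
          measure (Pr s i) (A \<inter> {\<omega>\<in>space M. X t \<omega> = j}) * measure (Pr t j) B) \<and>
     (\<forall>s\<in>{0..T}. \<forall>t\<in>{s..T}. \<forall>i\<in>{1,2}. \<forall>j\<in>{1,2}.
        ((\<lambda>u. measure (Pr s i) {\<omega>\<in>space M. X u \<omega> = j}) has_real_derivative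
           (\<Sum>k\<in>{1,2}. measure (Pr s i) {\<omega>\<in>space M. X t \<omega> = k} * G t k j)) (at t within {s..T}))"

definition bond_price ::
  "(real \<Rightarrow> nat \<Rightarrow> 'w measure) \<Rightarrow> (real \<Rightarrow> 'w \<Rightarrow> nat) \<Rightarrow> real
     \<Rightarrow> (nat \<Rightarrow> real) \<Rightarrow> (nat \<Rightarrow> real) \<Rightarrow> (nat \<Rightarrow> real) \<Rightarrow> real \<Rightarrow> nat \<Rightarrow> real" where
  "bond_price Q X T r h L t i =
     (\<integral>\<omega>. exp (- integral {t..T} (\<lambda>s. r (X s \<omega>) + h (X s \<omega>) * L (X s \<omega>))) \<partial>(Q t i))"

definition fraction_lower_bound :: "(real \<Rightarrow> nat \<Rightarrow> real) \<Rightarrow> real \<Rightarrow> nat \<Rightarrow> ereal" where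
  "fraction_lower_bound \<psi> t i =
     (if \<psi> t i < \<psi> t (3 - i) then ereal (- \<psi> t i / (\<psi> t (3 - i) - \<psi> t i)) else -\<infinity>)"

definition bond_fraction_eq ::
  "(nat \<Rightarrow> nat \<Rightarrow> real) \<Rightarrow> (nat \<Rightarrow> real) \<Rightarrow> (real \<Rightarrow> nat \<Rightarrow> real) \<Rightarrow> (real \<Rightarrow> nat \<Rightarrow> real)
     \<Rightarrow> real \<Rightarrow> nat \<Rightarrow> real \<Rightarrow> bool" where
  "bond_fraction_eq a h \<theta> \<psi> t i p \<longleftrightarrow>
     fraction_lower_bound \<psi> t i < ereal p \<and> p < 1 \<and>
     \<theta> t i - h i / (1 - p)
       - a i i * ((\<psi> t (3 - i) - \<psi> t i) / (\<psi> t i + p * (\<psi> t (3 - i) - \<psi> t i))) = 0"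

definition solves_K_system ::
  "real \<Rightarrow> (nat \<Rightarrow> nat \<Rightarrow> real) \<Rightarrow> (nat \<Rightarrow> real) \<Rightarrow> (real \<Rightarrow> nat \<Rightarrow> real) \<Rightarrow> bool" where
  "solves_K_system R a \<zeta> K \<longleftrightarrow>
     (\<forall>i\<in>{1,2}. K R i = 0 \<and>
        (\<forall>t\<in>{0..R}. \<exists>K\<^sub>t. ((\<lambda>s. K s i) has_real_derivative K\<^sub>t) (at t within {0..R}) \<and>
           K\<^sub>t + \<zeta> i - a i i * K t (3 - i) + a i i * K t i = 0))"

definition solves_J_system ::
  "real \<Rightarrow> (nat \<Rightarrow> nat \<Rightarrow> real) \<Rightarrow> (nat \<Rightarrow> real) \<Rightarrow> (nat \<Rightarrow> real) \<Rightarrow> (real \<Rightarrow> nat \<Rightarrow> real)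
     \<Rightarrow> (real \<Rightarrow> nat \<Rightarrow> real) \<Rightarrow> (real \<Rightarrow> nat \<Rightarrow> real) \<Rightarrow> (real \<Rightarrow> nat \<Rightarrow> real)
     \<Rightarrow> (real \<Rightarrow> nat \<Rightarrow> real) \<Rightarrow> bool" where
  "solves_J_system R a h \<zeta> \<theta> \<psi>t \<pi> K J \<longleftrightarrow>
     (\<forall>i\<in>{1,2}. J R i = 0 \<and>
        (\<forall>t\<in>{0..R}. \<exists>J\<^sub>t. ((\<lambda>s. J s i) has_real_derivative J\<^sub>t) (at t within {0..R}) \<and>
           J\<^sub>t + \<zeta> i + \<pi> t i * \<theta> t i + h i * (ln (1 - \<pi> t i) + K t i - J t i)
             - a i i * (ln (1 + \<pi> t i * \<psi>t t i) + J t (3 - i) - J t i) = 0))"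

definition K_formula ::
  "real \<Rightarrow> (nat \<Rightarrow> nat \<Rightarrow> real) \<Rightarrow> (nat \<Rightarrow> real) \<Rightarrow> real \<Rightarrow> nat \<Rightarrow> real" where
  "K_formula R a \<zeta> t i =
     1 / (a 1 1 + a 2 2)^2 *
       (\<zeta> (3 - i) * a i i *
          (1 - exp ((a 1 1 + a 2 2) * (R - t)) + (a 1 1 + a 2 2) * (R - t)) +
        \<zeta> i * ((a (3 - i) (3 - i))^2 * (R - t) +
          a i i * (exp ((a 1 1 + a 2 2) * (R - t)) - 1 + a (3 - i) (3 - i) * (R - t))))"

definition Delta ::
  "(nat \<Rightarrow> nat \<Rightarrow> real) \<Rightarrow> (nat \<Rightarrow> real) \<Rightarrow> (real \<Rightarrow> nat \<Rightarrow> real) \<Rightarrow> (real \<Rightarrow> nat \<Rightarrow> real)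
     \<Rightarrow> real \<Rightarrow> nat \<Rightarrow> real" where
  "Delta a h \<theta> \<psi>t t i =
     - 4 * \<theta> t i * \<psi>t t i * (h i - \<theta> t i + a i i * \<psi>t t i)
     + (\<theta> t i - a i i * \<psi>t t i + h i * \<psi>t t i - \<theta> t i * \<psi>t t i)^2"

definition g_fun ::
  "(nat \<Rightarrow> nat \<Rightarrow> real) \<Rightarrow> (nat \<Rightarrow> real) \<Rightarrow> (real \<Rightarrow> nat \<Rightarrow> real) \<Rightarrow> (real \<Rightarrow> nat \<Rightarrow> real)
     \<Rightarrow> (real \<Rightarrow> nat \<Rightarrow> real) \<Rightarrow> (real \<Rightarrow> nat \<Rightarrow> real) \<Rightarrow> real \<Rightarrow> nat \<Rightarrow> real" where
  "g_fun a h \<theta> \<psi>t \<pi> K t i =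
     \<pi> t i * \<theta> t i + h i * (ln (1 - \<pi> t i) + K t i) - a i i * ln (1 + \<pi> t i * \<psi>t t i)"

definition c_coef :: "(nat \<Rightarrow> nat \<Rightarrow> real) \<Rightarrow> (nat \<Rightarrow> real) \<Rightarrow> nat \<Rightarrow> real" where
  "c_coef a h i = h i - a i i"

definition c_plus :: "(nat \<Rightarrow> nat \<Rightarrow> real) \<Rightarrow> (nat \<Rightarrow> real) \<Rightarrow> real" where
  "c_plus a h = (c_coef a h 2 - c_coef a h 1)^2 + 4 * a 1 1 * a 2 2"

definition I_int ::
  "real \<Rightarrow> (nat \<Rightarrow> nat \<Rightarrow> real) \<Rightarrow> (nat \<Rightarrow> real) \<Rightarrow> (nat \<Rightarrow> real) \<Rightarrow> (real \<Rightarrow> nat \<Rightarrow> real)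
     \<Rightarrow> real \<Rightarrow> nat \<Rightarrow> real" where
  "I_int R a h \<zeta> g t i =
     (let c = c_coef a h; w = sqrt (c_plus a h); \<epsilon> = 3 - 2 * real i in
      integral {t..R} (\<lambda>s. exp (- (s * (w + c 1 + c 2) / 2)) *
        (2 * (exp (s * w) - 1) * (h i - c i) * (\<zeta> (3 - i) + g s (3 - i))
         + (\<epsilon> * (c 2 - c 1) - w - exp (s * w) * (\<epsilon> * (c 2 - c 1) + w)) * (\<zeta> i + g s i))))"

definition I_tilde_int ::
  "real \<Rightarrow> (nat \<Rightarrow> nat \<Rightarrow> real) \<Rightarrow> (nat \<Rightarrow> real) \<Rightarrow> (nat \<Rightarrow> real) \<Rightarrow> (real \<Rightarrow> nat \<Rightarrow> real)
     \<Rightarrow> real \<Rightarrow> nat \<Rightarrow> real" where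
  "I_tilde_int R a h \<zeta> g t i =
     (let c = c_coef a h; w = sqrt (c_plus a h); \<epsilon> = 3 - 2 * real i in
      integral {t..R} (\<lambda>s. exp (- (s * (w + c 1 + c 2) / 2)) *
        ((- w + exp (s * w) * (\<epsilon> * (c 2 - c 1) - w) - \<epsilon> * (c 2 - c 1)) * (\<zeta> (3 - i) + g s (3 - i))
         + 2 * (exp (s * w) - 1) * (h (3 - i) - c (3 - i)) * (\<zeta> i + g s i))))"

text \<open>
  The pre-default system is \<open>J' = B J - (\<zeta> + g)\<close> with \<open>B\<close> having diagonal \<open>c\<^sub>1, c\<^sub>2\<close> and off-diagonal
  \<open>a\<^sub>1\<^sub>1, a\<^sub>2\<^sub>2\<close>; its eigenvalues are \<open>(c\<^sub>1 + c\<^sub>2 \<plusminus> w) / 2\<close> with \<open>w\<close> the square root of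
  \<open>c_plus\<close>. The formula is row \<open>i\<close> of \<open>\<integral> exp ((t - s) B) (\<zeta> + g s) ds\<close>, with the exponential split as
  \<open>exp (t B) exp (- s B)\<close>. The \<open>i\<close>-th diagonal entry of \<open>exp (t B)\<close> has \<open>sinh\<close> coefficient
  \<open>(c\<^sub>i - c\<^sub>j) / w\<close> with \<open>j = 3 - i\<close>, whence the sign \<open>\<epsilon> = 3 - 2 i\<close> in front of
  \<open>c\<^sub>2 - c\<^sub>1\<close> outside the integrals as well as inside them. Without that sign outside, the
  expression for \<open>i = 2\<close> would not solve the system unless \<open>c\<^sub>1 = c\<^sub>2\<close> or \<open>I_int\<close> vanishes.
\<close>

definition J_formula ::
  "real \<Rightarrow> (nat \<Rightarrow> nat \<Rightarrow> real) \<Rightarrow> (nat \<Rightarrow> real) \<Rightarrow> (nat \<Rightarrow> real) \<Rightarrow> (real \<Rightarrow> nat \<Rightarrow> real)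
     \<Rightarrow> real \<Rightarrow> nat \<Rightarrow> real" where
  "J_formula R a h \<zeta> g t i =
     (let c = c_coef a h; w = sqrt (c_plus a h); \<epsilon> = 3 - 2 * real i in
      1 / (2 * c_plus a h) * exp (t * (c 1 + c 2) / 2) *
        ((- w * cosh (t * w / 2) + \<epsilon> * (c 2 - c 1) * sinh (t * w / 2)) * I_int R a h \<zeta> g t i
         - 2 * (h i - c i) * sinh (t * w / 2) * I_tilde_int R a h \<zeta> g t i))"

end

theory Submission
  imports Defs
begin

text \<open>
  Both systems are linear with constant coefficients and a terminal condition. A Gronwall argument for the
  sum of squares of the difference of two solutions gives uniqueness, so it suffices to differentiate the
  formulas; for \<open>J\<close> this needs the source term to be continuous in \<open>t\<close>, and hence the bond prices to
  be so. By the Markov property, \<open>\<psi>\<^sub>i(s)\<close> differs from \<open>\<Sum>\<^sub>j Q(X\<^sub>t = j | X\<^sub>s = i) \<psi>\<^sub>j(t)\<close> only by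
  the discounting over \<open>[s,t]\<close>, which is \<open>O(t - s)\<close>, and by the forward equation the probability of
  leaving \<open>i\<close> is \<open>O(t - s)\<close> too; so \<open>\<psi>\<^sub>i\<close> is Lipschitz. The equation for the bond fraction is
  strictly decreasing in the fraction: this makes its root continuous in \<open>t\<close>, and it selects the root
  with the plus sign of the quadratic equation obtained by clearing denominators.
\<close>

section \<open>Uniqueness for linear terminal value problems\<close>

text \<open>Backwards in time \<open>x*x + y*y\<close> grows at most exponentially, so multiplied by
  \<open>exp (C * s)\<close> it is nondecreasing in s. It is nonnegative and vanishes at
  \<open>R\<close>, hence everywhere before.\<close>

lemma linear_system_zero:
  fixes x y :: "real \<Rightarrow> real"
  assumes x: "\<And>t. t \<in> {0..R} \<Longrightarrow> (x has_real_derivative p * x t + q * y t) (at t within {0..R})"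
    and y: "\<And>t. t \<in> {0..R} \<Longrightarrow> (y has_real_derivative p' * y t + q' * x t) (at t within {0..R})"
    and terminal: "x R = 0" "y R = 0" and t: "t \<in> {0..R}"
  shows "x t = 0 \<and> y t = 0"
proof -
  \<comment> \<open>The derivative of \<open>x*x + y*y\<close> is
    \<open>2*p*x*x + 2*p'*y*y + 2*(q + q')*x*y\<close>; since
    \<open>2*\<bar>x*y\<bar> \<le> x*x + y*y\<close>, its absolute value is at most \<open>C\<close>
    times \<open>x*x + y*y\<close>.\<close>
  define C where "C = 2 * \<bar>p\<bar> + 2 * \<bar>p'\<bar> + \<bar>q + q'\<bar>"
  define E where "E s = (x s * x s + y s * y s) * exp (C * s)" for s
  define E' where "E' s = (2 * p * (x s * x s) + 2 * p' * (y s * y s) + 2 * (q + q') * (x s * y s)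
      + C * (x s * x s + y s * y s)) * exp (C * s)" for s
  have deriv: "(E has_real_derivative E' s) (at s within {0..R})" if "s \<in> {0..R}" for s
    unfolding E_def E'_def
    by (auto intro!: derivative_eq_intros x[OF that] y[OF that] simp: algebra_simps)
  have nonneg: "E' s \<ge> 0" for s
  proof -
    have sq: "0 \<le> x s * x s" "0 \<le> y s * y s" by simp_all
    have "\<bar>2 * (x s * y s)\<bar> \<le> x s * x s + y s * y s"
      using sum_squares_bound[of "x s" "y s"] sum_squares_bound[of "x s" "- y s"]
      by (simp add: abs_le_iff power2_eq_square mult.assoc)
    then have "\<bar>(q + q') * (2 * (x s * y s))\<bar> \<le> \<bar>q + q'\<bar> * (x s * x s + y s * y s)"
      unfolding abs_mult[of "q + q'"] by (rule mult_left_mono) simp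
    moreover have "- (2 * \<bar>p\<bar> * (x s * x s)) \<le> 2 * p * (x s * x s)"
      using mult_right_mono[OF _ sq(1), of "- 2 * \<bar>p\<bar>" "2 * p"] by simp
    moreover have "- (2 * \<bar>p'\<bar> * (y s * y s)) \<le> 2 * p' * (y s * y s)"
      using mult_right_mono[OF _ sq(2), of "- 2 * \<bar>p'\<bar>" "2 * p'"] by simp
    moreover have "0 \<le> 2 * \<bar>p\<bar> * (y s * y s)" "0 \<le> 2 * \<bar>p'\<bar> * (x s * x s)"
      using sq by simp_all
    ultimately have "0 \<le> 2 * p * (x s * x s) + 2 * p' * (y s * y s) + 2 * (q + q') * (x s * y s)
        + C * (x s * x s + y s * y s)"
      unfolding C_def abs_le_iff by (simp only: algebra_simps) linarith
    then show ?thesis unfolding E'_def by simp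
  qed
  have "E t \<le> E R"
  \<comment> \<open>At interior points the derivative within \<open>{0..R}\<close> is the two-sided
    one; at the endpoints continuity suffices.\<close>
  proof (rule DERIV_nonneg_imp_increasing_open[of t R E])
    show "t \<le> R" using t by simp
    show "\<exists>d. (E has_real_derivative d) (at s) \<and> 0 \<le> d" if "t < s" "s < R" for s
      using deriv[of s] nonneg[of s] that t at_within_Icc_at[of 0 s R] by auto
    show "continuous_on {t..R} E"
      using deriv t by (intro continuous_on_subset[OF DERIV_continuous_on[of "{0..R}" E E']]) auto
  qed
  then have "x t * x t + y t * y t \<le> 0"
    by (simp add: E_def terminal mult_le_0_iff)
  then show ?thesis by (simp add: sum_squares_le_zero_iff)
qed

text \<open>The common source \<open>F\<close> cancels in the difference of the two solutions, which
  leaves the homogeneous problem.\<close>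

lemma linear_system_unique:
  fixes f :: "real \<Rightarrow> nat \<Rightarrow> real"
  assumes f: "\<And>i t. i \<in> {1,2} \<Longrightarrow> t \<in> {0..R} \<Longrightarrow>
      ((\<lambda>s. f s i) has_real_derivative p i * f t i + q i * f t (3 - i) - F t i) (at t within {0..R})"
    and g: "\<And>i t. i \<in> {1,2} \<Longrightarrow> t \<in> {0..R} \<Longrightarrow>
      ((\<lambda>s. g s i) has_real_derivative p i * g t i + q i * g t (3 - i) - F t i) (at t within {0..R})"
    and terminal: "\<And>i. i \<in> {1,2} \<Longrightarrow> f R i = g R i" and i: "i \<in> {1,2}" and t: "t \<in> {0..R}"
  shows "f t i = g t i"
proof -
  have d: "((\<lambda>s. f s i - g s i) has_real_derivative
      p i * (f t i - g t i) + q i * (f t (3 - i) - g t (3 - i))) (at t within {0..R})"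
    if "i \<in> {1,2}" "t \<in> {0..R}" for i t
    using DERIV_diff[OF f g, OF that that] by (simp add: algebra_simps)
  have "f t 1 - g t 1 = 0 \<and> f t 2 - g t 2 = 0"
    by (rule linear_system_zero[of R _ "p 1" "q 1" _ "p 2" "q 2"])
      (use d[of 1] d[of 2] terminal t in auto)
  then show ?thesis using i by auto
qed

section \<open>The post-default system and the normal form of both systems\<close>

text \<open>The system matrix has eigenvalues 0 and \<open>- (a 1 1 + a 2 2)\<close>, which is where
  the linear and the exponential terms of the formula come from. If the sum were 0, the prefactor
  \<open>1 / 0 = 0\<close> would make the formula vanish identically.\<close>

lemma K_formula_deriv:
  assumes i: "i \<in> {1,2}" and "a 1 1 + a 2 2 \<noteq> 0"
  shows "((\<lambda>t. K_formula R a \<zeta> t i) has_real_derivative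
     - a i i * K_formula R a \<zeta> t i + a i i * K_formula R a \<zeta> t (3 - i) - \<zeta> i) (at t within S)"
proof -
  define s e k where "s = a 1 1 + a 2 2" and "e = exp (s * (R - t))" and "k = 1 / s\<^sup>2"
  have s0: "s \<noteq> 0" using assms(2) by (simp add: s_def)
  have s: "s = a i i + a (3 - i) (3 - i)" using i by (auto simp: s_def)
  have "((\<lambda>t. K_formula R a \<zeta> t i) has_real_derivative
     k * (\<zeta> (3 - i) * a i i * (s * e - s) +
       \<zeta> i * (- (a (3 - i) (3 - i))\<^sup>2 + a i i * (- s * e - a (3 - i) (3 - i))))) (at t within S)"
    unfolding K_formula_def s_def[symmetric] e_def k_def[symmetric]
    by (auto intro!: derivative_eq_intros simp: algebra_simps)
  also have "k * (\<zeta> (3 - i) * a i i * (s * e - s) +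
       \<zeta> i * (- (a (3 - i) (3 - i))\<^sup>2 + a i i * (- s * e - a (3 - i) (3 - i)))) =
     - a i i * K_formula R a \<zeta> t i + a i i * K_formula R a \<zeta> t (3 - i) - \<zeta> i"
  proof -
    define b d z y where "b = a (3 - i) (3 - i)" and "d = a i i" and "z = \<zeta> i" and "y = \<zeta> (3 - i)"
    have 3: "3 - (3 - i) = i" using i by auto
    \<comment> \<open>With \<open>b\<close> eliminated, powers of \<open>s\<close> are the only
      denominators and a polynomial identity remains.\<close>
    have sbd: "b = s - d" using s by (simp add: b_def d_def)
    show ?thesis
      unfolding K_formula_def s_def[symmetric] e_def[symmetric] 3
      unfolding k_def b_def[symmetric] d_def[symmetric] z_def[symmetric] y_def[symmetric] sbd
      using s0 by (simp add: divide_simps) (simp add: algebra_simps power2_eq_square)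
  qed
  finally show ?thesis .
qed

text \<open>The equation determines the existentially quantified derivative; solving for it gives
  the shape that \<open>linear_system_unique\<close> expects.\<close>

lemma solves_K_system_alt:
  "solves_K_system R a \<zeta> K \<longleftrightarrow> (\<forall>i\<in>{1,2}. K R i = 0 \<and> (\<forall>t\<in>{0..R}.
     ((\<lambda>s. K s i) has_real_derivative - a i i * K t i + a i i * K t (3 - i) - \<zeta> i) (at t within {0..R})))"
proof -
  have eq: "(\<exists>K'. (f has_real_derivative K') G \<and> K' + z - b + c = 0) \<longleftrightarrow> (f has_real_derivative - c + b - z) G"
    for f G and b c z :: real
  proof -
    have "K' + z - b + c = 0 \<longleftrightarrow> K' = - c + b - z" for K' by auto
    then show ?thesis by simp
  qed
  show ?thesis unfolding solves_K_system_def eq by simp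
qed

text \<open>The terms in \<open>J t i\<close> combine to the coefficient \<open>h i - a i i\<close>,
  that is, \<open>c_coef a h i\<close>; what is free of \<open>J\<close> is the source.\<close>

lemma solves_J_system_alt:
  "solves_J_system R a h \<zeta> \<theta> \<psi>t \<pi> K J \<longleftrightarrow> (\<forall>i\<in>{1,2}. J R i = 0 \<and> (\<forall>t\<in>{0..R}.
     ((\<lambda>s. J s i) has_real_derivative
       c_coef a h i * J t i + a i i * J t (3 - i) - (\<zeta> i + g_fun a h \<theta> \<psi>t \<pi> K t i)) (at t within {0..R})))"
proof -
  have eq: "(\<exists>J'. (f has_real_derivative J') G \<and>
        J' + \<zeta> i + \<pi> t i * \<theta> t i + h i * (ln (1 - \<pi> t i) + K t i - J t i)
             - a i i * (ln (1 + \<pi> t i * \<psi>t t i) + J t (3 - i) - J t i) = 0) \<longleftrightarrow>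
      (f has_real_derivative
        c_coef a h i * J t i + a i i * J t (3 - i) - (\<zeta> i + g_fun a h \<theta> \<psi>t \<pi> K t i)) G"
    for f G t i
  proof -
    have "J' + \<zeta> i + \<pi> t i * \<theta> t i + h i * (ln (1 - \<pi> t i) + K t i - J t i)
             - a i i * (ln (1 + \<pi> t i * \<psi>t t i) + J t (3 - i) - J t i) = 0 \<longleftrightarrow>
       J' = c_coef a h i * J t i + a i i * J t (3 - i) - (\<zeta> i + g_fun a h \<theta> \<psi>t \<pi> K t i)" for J'
      unfolding c_coef_def g_fun_def by (auto simp: algebra_simps)
    then show ?thesis by simp
  qed
  show ?thesis unfolding solves_J_system_def eq by simp
qed

lemma K_formula_terminal: "K_formula R a \<zeta> R i = 0"
  by (simp add: K_formula_def)

text \<open>One direction is uniqueness; the other transfers the derivative of the formula to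
  \<open>K\<close>.\<close>

lemma K_formula_iff:
  assumes "0 < R" and ne: "a 1 1 + a 2 2 \<noteq> 0"
  shows "solves_K_system R a \<zeta> K \<longleftrightarrow> (\<forall>t\<in>{0..R}. \<forall>i\<in>{1,2}. K t i = K_formula R a \<zeta> t i)"
proof
  assume K: "solves_K_system R a \<zeta> K"
  show "\<forall>t\<in>{0..R}. \<forall>i\<in>{1,2}. K t i = K_formula R a \<zeta> t i"
  proof (intro ballI)
    fix t and i :: nat assume "i \<in> {1,2}" "t \<in> {0..R}"
    then show "K t i = K_formula R a \<zeta> t i"
    proof (rule linear_system_unique[rotated 3])
      show "((\<lambda>s. K s i) has_real_derivative - a i i * K t i + a i i * K t (3 - i) - \<zeta> i) (at t within {0..R})"
        if "i \<in> {1,2}" "t \<in> {0..R}" for i t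
        using K that unfolding solves_K_system_alt by blast
      show "K R i = K_formula R a \<zeta> R i" if "i \<in> {1,2}" for i
        using K that K_formula_terminal unfolding solves_K_system_alt by force
    qed (rule K_formula_deriv[where a = a, OF _ ne])
  qed
next
  assume eq: "\<forall>t\<in>{0..R}. \<forall>i\<in>{1,2}. K t i = K_formula R a \<zeta> t i"
  show "solves_K_system R a \<zeta> K" unfolding solves_K_system_alt
  proof (intro ballI conjI)
    fix i :: nat assume i: "i \<in> {1,2}"
    show "K R i = 0" using eq i K_formula_terminal \<open>0 < R\<close> by force
    fix t assume t: "t \<in> {0..R}"
    have d: "((\<lambda>s. K_formula R a \<zeta> s i) has_real_derivative
        - a i i * K_formula R a \<zeta> t i + a i i * K_formula R a \<zeta> t (3 - i) - \<zeta> i) (at t within {0..R})"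
      by (rule K_formula_deriv[where a = a]) fact+
    have "K t i = K_formula R a \<zeta> t i" "K t (3 - i) = K_formula R a \<zeta> t (3 - i)"
      using eq t i by auto
    \<comment> \<open>\<open>K\<close> is known only on \<open>{0..R}\<close>, which is enough for a
      derivative within that interval; any positive radius serves, here 1.\<close>
    moreover have "((\<lambda>s. K s i) has_real_derivative - a i i * K_formula R a \<zeta> t i
        + a i i * K_formula R a \<zeta> t (3 - i) - \<zeta> i) (at t within {0..R})"
      by (rule has_field_derivative_transform_within[OF d zero_less_one t]) (use eq i in auto)
    ultimately show "((\<lambda>s. K s i) has_real_derivative - a i i * K t i + a i i * K t (3 - i) - \<zeta> i) (at t within {0..R})"
      by simp
  qed
qed

section \<open>The pre-default system\<close>

text \<open>Exchanging the states replaces \<epsilon> by its negative, which turns one integrand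
  into the other. Hence only one family of integrals has to be differentiated.\<close>

lemma I_tilde_int_eq:
  assumes "i \<in> {1,2}"
  shows "I_tilde_int R a h \<zeta> g t i = I_int R a h \<zeta> g t (3 - i)"
  using assms by (auto simp: I_tilde_int_def I_int_def Let_def algebra_simps intro!: integral_cong)

text \<open>Variation of constants. The product rule gives a homogeneous part, in which the two
  integrals act as constants (\<open>hom\<close>), and a part from their lower limits, which
  produces the source (\<open>inh\<close>).\<close>

lemma J_formula_deriv:
  assumes i: "i \<in> {1,2}" and pos: "0 < c_plus a h" and t: "t \<in> {0..R}"
    and cont: "\<And>i. i \<in> {1,2} \<Longrightarrow> continuous_on {0..R} (\<lambda>t. g t i)"
  shows "((\<lambda>t. J_formula R a h \<zeta> g t i) has_real_derivative
     c_coef a h i * J_formula R a h \<zeta> g t i + a i i * J_formula R a h \<zeta> g t (3 - i)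
       - (\<zeta> i + g t i)) (at t within {0..R})"
proof -
  \<comment> \<open>\<open>d\<close> absorbs the sign \<epsilon>: it equals \<open>c j - c i\<close>
    and changes sign under exchange of the states. The eigenvalues of the system are
    \<open>m + w / 2\<close> and \<open>m - w / 2\<close>.\<close>
  define c w d m where "c = c_coef a h" and "w = sqrt (c_plus a h)"
    and "d = (3 - 2 * real i) * (c 2 - c 1)" and "m = (c 1 + c 2) / 2"
  define j F where "j = 3 - i" and "F s k = \<zeta> k + g s k" for s k
  have w: "w > 0" using pos by (simp add: w_def)
  have hc: "h k - c k = a k k" for k by (simp add: c_def c_coef_def)
  have d: "d = c j - c i" "m - c i = d / 2"
      "- d = (3 - 2 * real j) * (c 2 - c 1)"
    using i by (auto simp: d_def j_def m_def field_simps)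
  have c: "c 1 + c 2 = 2 * m" by (simp add: m_def)
  have w2: "w\<^sup>2 = d\<^sup>2 + 4 * a i i * a j j"
    using i pos by (auto simp: w_def c_plus_def d_def j_def c_def power2_commute)
  \<comment> \<open>The integrand of \<open>I_int\<close> for state \<open>k\<close> with other
    state \<open>l\<close>; \<open>e\<close> is \<open>d\<close> for one state and
    \<open>- d\<close> for the other.\<close>
  define \<phi> where "\<phi> k l e s = exp (- (s * (w + 2 * m) / 2)) *
      (2 * (exp (s * w) - 1) * a k k * F s l + (e - w - exp (s * w) * (e + w)) * F s k)" for k l e s
  have j: "j \<in> {1,2}" "3 - j = i" using i by (auto simp: j_def)
  have I: "I_int R a h \<zeta> g t i = integral {t..R} (\<phi> i j d)"
       "I_int R a h \<zeta> g t j = integral {t..R} (\<phi> j i (- d))" for t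
    unfolding I_int_def Let_def c_def[symmetric] w_def[symmetric] \<phi>_def
    by (simp_all only: j j_def[symmetric] d_def[symmetric] d(3)[symmetric] hc add.assoc c F_def)
  have contF: "continuous_on {0..R} (\<lambda>t. F t k)" if "k \<in> {1,2}" for k
    unfolding F_def by (intro continuous_intros cont that)
  \<comment> \<open>The fundamental theorem at the lower limit, whence the minus sign; it is here
    that continuity of \<open>g\<close> enters.\<close>
  have dI: "((\<lambda>t. I_int R a h \<zeta> g t i) has_real_derivative - \<phi> i j d t) (at t within {0..R})"
      "((\<lambda>t. I_int R a h \<zeta> g t j) has_real_derivative - \<phi> j i (- d) t) (at t within {0..R})"
    unfolding I using t i j
    by (intro integral_has_real_derivative'; auto simp: \<phi>_def intro!: continuous_intros contF)+
  define p q where "p = I_int R a h \<zeta> g t i" and "q = I_int R a h \<zeta> g t j"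
  define E G where "E = exp (t * w / 2)" and "G = exp (t * m)"
  have E: "E > 0" "G > 0" by (simp_all add: E_def G_def)
  define Ch Sh where "Ch = cosh (t * w / 2)" and "Sh = sinh (t * w / 2)"
  have J: "J_formula R a h \<zeta> g t i = 1 / (2 * w\<^sup>2) * exp (t * m) *
      ((- w * cosh (t * w / 2) + d * sinh (t * w / 2)) * I_int R a h \<zeta> g t i
         - 2 * a i i * sinh (t * w / 2) * I_int R a h \<zeta> g t j)"
     "J_formula R a h \<zeta> g t j = 1 / (2 * w\<^sup>2) * exp (t * m) *
      ((- w * cosh (t * w / 2) - d * sinh (t * w / 2)) * I_int R a h \<zeta> g t j
         - 2 * a j j * sinh (t * w / 2) * I_int R a h \<zeta> g t i)" for t
    unfolding J_formula_def Let_def I_tilde_int_eq[OF i] I_tilde_int_eq[OF j(1)] j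
      c_def[symmetric] w_def[symmetric] d_def[symmetric] d(3)[symmetric] hc c j_def[symmetric]
    using pos by (simp_all add: w_def)
  define k where "k = 1 / (2 * w\<^sup>2)"
  have "((\<lambda>t. J_formula R a h \<zeta> g t i) has_real_derivative
      k * (m * G * ((- w * Ch + d * Sh) * p - 2 * a i i * Sh * q)
      + G * ((- w * (w / 2) * Sh + d * (w / 2) * Ch) * p - (- w * Ch + d * Sh) * \<phi> i j d t
         - 2 * a i i * (w / 2) * Ch * q + 2 * a i i * Sh * \<phi> j i (- d) t))) (at t within {0..R})"
    unfolding J k_def[symmetric] p_def q_def G_def Ch_def Sh_def
    by (auto intro!: derivative_eq_intros dI simp: algebra_simps)
  moreover have "k * (m * G * ((- w * Ch + d * Sh) * p - 2 * a i i * Sh * q)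
      + G * ((- w * (w / 2) * Sh + d * (w / 2) * Ch) * p - (- w * Ch + d * Sh) * \<phi> i j d t
         - 2 * a i i * (w / 2) * Ch * q + 2 * a i i * Sh * \<phi> j i (- d) t)) =
      c i * J_formula R a h \<zeta> g t i + a i i * J_formula R a h \<zeta> g t j - F t i"
  proof -
    \<comment> \<open>All exponentials are rewritten through \<open>E\<close> and \<open>G\<close>,
      so that the factor of the integrand at time t cancels the outer factor \<open>G\<close> and
      leaves hyperbolic functions.\<close>
    have E2: "exp (t * w) = E * E" by (simp add: E_def flip: exp_add)
    have EG: "exp (- (t * (w + 2 * m) / 2)) = 1 / (E * G)"
      by (simp add: E_def G_def exp_minus field_simps flip: exp_add)
    have ChE: "Ch = (E + 1 / E) / 2" and ShE: "Sh = (E - 1 / E) / 2"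
      by (simp_all add: Ch_def Sh_def E_def cosh_def sinh_def exp_minus divide_simps)
    have CS: "Ch * Ch - Sh * Sh = 1"
      using cosh_square_eq[of "t * w / 2"] by (simp add: Ch_def Sh_def power2_eq_square)
    have \<phi>: "G * \<phi> i j d t = 4 * Sh * a i i * F t j - (2 * d * Sh + 2 * w * Ch) * F t i"
        "G * \<phi> j i (- d) t = 4 * Sh * a j j * F t i + (2 * d * Sh - 2 * w * Ch) * F t j"
      unfolding \<phi>_def E2 EG ChE ShE using E by (simp_all add: field_simps)
    have hom: "k * (m * G * ((- w * Ch + d * Sh) * p - 2 * a i i * Sh * q)
      + G * ((- w * (w / 2) * Sh + d * (w / 2) * Ch) * p - 2 * a i i * (w / 2) * Ch * q)) =
      c i * J_formula R a h \<zeta> g t i + a i i * J_formula R a h \<zeta> g t j"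
    proof -
      have m: "m = c i + d / 2" using d(2) by simp
      have ww: "w * w = d * d + 4 * a i i * a j j" using w2 by (simp add: power2_eq_square)
      \<comment> \<open>The defect in the homogeneous equation is a multiple of
        \<open>d * d + 4 * a i i * a j j - w * w\<close>, which \<open>ww\<close> makes
        zero.\<close>
      have eq: "m * G * ((- w * Ch + d * Sh) * p - 2 * a i i * Sh * q)
        + G * ((- w * (w / 2) * Sh + d * (w / 2) * Ch) * p - 2 * a i i * (w / 2) * Ch * q) =
        c i * (G * ((- w * Ch + d * Sh) * p - 2 * a i i * Sh * q)) +
        a i i * (G * ((- w * Ch - d * Sh) * q - 2 * a j j * Sh * p))
        + G * Sh * p / 2 * (d * d + 4 * a i i * a j j - w * w)"
        unfolding m by (simp add: field_simps)
      show ?thesis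
        unfolding J k_def[symmetric] p_def[symmetric] q_def[symmetric] G_def[symmetric]
          Ch_def[symmetric] Sh_def[symmetric] eq ww by (simp add: algebra_simps)
    qed
    \<comment> \<open>In coordinates, the product of the matrix exponential and its inverse: the
      terms in \<open>F t j\<close> cancel, and \<open>Ch * Ch - Sh * Sh = 1\<close> reduces those
      in \<open>F t i\<close>.\<close>
    have inh: "- (- w * Ch + d * Sh) * (G * \<phi> i j d t) + 2 * a i i * Sh * (G * \<phi> j i (- d) t) = - 2 * w\<^sup>2 * F t i"
    proof -
      have "- (- w * Ch + d * Sh) * (G * \<phi> i j d t) + 2 * a i i * Sh * (G * \<phi> j i (- d) t) =
         2 * F t i * (Sh * Sh * (d * d + 4 * a i i * a j j) - w * w * (Ch * Ch))"
        unfolding \<phi> by (simp add: algebra_simps)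
      also have "\<dots> = 2 * F t i * (w * w) * (Sh * Sh - Ch * Ch)"
        using w2 by (simp add: power2_eq_square algebra_simps)
      also have "\<dots> = - 2 * w\<^sup>2 * F t i" using CS by (simp add: power2_eq_square) (simp add: algebra_simps)
      finally show ?thesis .
    qed
    have "k * (- 2 * w\<^sup>2 * F t i) = - F t i" using w by (simp add: k_def)
    then show ?thesis unfolding inh[symmetric] using hom by (simp add: algebra_simps)
  qed
  ultimately show ?thesis by (simp add: c_def j_def F_def)
qed

lemma J_formula_terminal: "J_formula R a h \<zeta> g R i = 0"
  by (simp add: J_formula_def I_int_def I_tilde_int_def Let_def)

text \<open>The scheme of \<open>K_formula_iff\<close>. Continuity of the source makes the integrals
  differentiable in their lower limit.\<close>

lemma J_formula_iff:
  assumes "0 < R" and pos: "0 < c_plus a h"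
    and cont: "\<And>i. i \<in> {1,2} \<Longrightarrow> continuous_on {0..R} (\<lambda>t. g_fun a h \<theta> \<psi>t \<pi> K t i)"
  shows "solves_J_system R a h \<zeta> \<theta> \<psi>t \<pi> K J \<longleftrightarrow>
     (\<forall>t\<in>{0..R}. \<forall>i\<in>{1,2}. J t i = J_formula R a h \<zeta> (g_fun a h \<theta> \<psi>t \<pi> K) t i)"
  (is "_ \<longleftrightarrow> (\<forall>t\<in>_. \<forall>i\<in>_. J t i = ?J t i)")
proof
  assume J: "solves_J_system R a h \<zeta> \<theta> \<psi>t \<pi> K J"
  show "\<forall>t\<in>{0..R}. \<forall>i\<in>{1,2}. J t i = ?J t i"
  proof (intro ballI)
    fix t and i :: nat assume "i \<in> {1,2}" "t \<in> {0..R}"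
    then show "J t i = ?J t i"
    proof (rule linear_system_unique[rotated 3])
      show "((\<lambda>s. J s i) has_real_derivative c_coef a h i * J t i + a i i * J t (3 - i)
          - (\<zeta> i + g_fun a h \<theta> \<psi>t \<pi> K t i)) (at t within {0..R})"
        if "i \<in> {1,2}" "t \<in> {0..R}" for i t
        using J that unfolding solves_J_system_alt by blast
      show "J R i = ?J R i" if "i \<in> {1,2}" for i
        using J that J_formula_terminal unfolding solves_J_system_alt by force
    qed (rule J_formula_deriv[OF _ pos _ cont])
  qed
next
  assume eq: "\<forall>t\<in>{0..R}. \<forall>i\<in>{1,2}. J t i = ?J t i"
  show "solves_J_system R a h \<zeta> \<theta> \<psi>t \<pi> K J" unfolding solves_J_system_alt
  proof (intro ballI conjI)
    fix i :: nat assume i: "i \<in> {1,2}"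
    show "J R i = 0" using eq i J_formula_terminal \<open>0 < R\<close> by force
    fix t assume t: "t \<in> {0..R}"
    have d: "((\<lambda>s. ?J s i) has_real_derivative c_coef a h i * ?J t i + a i i * ?J t (3 - i)
          - (\<zeta> i + g_fun a h \<theta> \<psi>t \<pi> K t i)) (at t within {0..R})"
      by (rule J_formula_deriv) fact+
    have "J t i = ?J t i" "J t (3 - i) = ?J t (3 - i)"
      using eq t i by auto
    moreover have "((\<lambda>s. J s i) has_real_derivative c_coef a h i * ?J t i + a i i * ?J t (3 - i)
          - (\<zeta> i + g_fun a h \<theta> \<psi>t \<pi> K t i)) (at t within {0..R})"
      by (rule has_field_derivative_transform_within[OF d zero_less_one t]) (use eq i in auto)
    ultimately show "((\<lambda>s. J s i) has_real_derivative c_coef a h i * J t i + a i i * J t (3 - i)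
          - (\<zeta> i + g_fun a h \<theta> \<psi>t \<pi> K t i)) (at t within {0..R})"
      by simp
  qed
qed

section \<open>The optimal bond fraction\<close>

text \<open>First-order condition for the fraction, where \<open>x = \<psi>\<^sub>j / \<psi>\<^sub>i - 1\<close> and \<open>b = a\<^sub>i\<^sub>i\<close>.\<close>

definition foc :: "real \<Rightarrow> real \<Rightarrow> real \<Rightarrow> real \<Rightarrow> real \<Rightarrow> real" where
  "foc \<theta> h b x p = \<theta> - h / (1 - p) - b * x / (1 + p * x)"

text \<open>Division by \<open>\<psi> t i\<close> merges the two cases of the lower bound into
  positivity of \<open>1 + p * x\<close>. For \<open>x > 0\<close> this is
  \<open>p > - 1 / x\<close>; for \<open>x \<le> 0\<close> it is automatic, because
  \<open>p < 1\<close> and \<open>x > -1\<close> give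
  \<open>1 + p * x \<ge> 1 + x > 0\<close>.\<close>

lemma bond_fraction_eq_iff:
  assumes "\<psi> t i > 0" "\<psi> t (3 - i) > 0"
  shows "bond_fraction_eq a h \<theta> \<psi> t i p \<longleftrightarrow> p < 1 \<and> 0 < 1 + p * (\<psi> t (3 - i) / \<psi> t i - 1) \<and>
     foc (\<theta> t i) (h i) (a i i) (\<psi> t (3 - i) / \<psi> t i - 1) p = 0"
proof -
  define x where "x = \<psi> t (3 - i) / \<psi> t i - 1"
  have x: "x > -1" using assms by (simp add: x_def)
  have diff: "\<psi> t (3 - i) - \<psi> t i = \<psi> t i * x" using assms by (simp add: x_def field_simps)
  have "fraction_lower_bound \<psi> t i < ereal p \<longleftrightarrow> 0 < 1 + p * x" if "p < 1"
  proof (cases "\<psi> t i < \<psi> t (3 - i)")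
    case True
    then have "0 < \<psi> t i * x" using diff by simp
    then have "x > 0" using assms(1) by (simp add: zero_less_mult_iff)
    then show ?thesis
      using True assms(1)
      by (simp add: fraction_lower_bound_def diff minus_less_iff[of _ p] pos_less_divide_eq) linarith
  next
    case False
    then have "\<psi> t i * x \<le> 0" using diff by linarith
    then have "x \<le> 0" using assms(1) by (simp add: mult_le_0_iff)
    then have "x \<le> p * x" using mult_right_mono_neg[of p 1 x] that by simp
    then show ?thesis using False x by (simp add: fraction_lower_bound_def)
  qed
  moreover have "(\<psi> t (3 - i) - \<psi> t i) / (\<psi> t i + p * (\<psi> t (3 - i) - \<psi> t i)) = x / (1 + p * x)"
  proof -
    have "\<psi> t i + p * (\<psi> t i * x) = \<psi> t i * (1 + p * x)" by (simp add: algebra_simps)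
    then show ?thesis using assms(1) unfolding diff by simp
  qed
  ultimately show ?thesis
    unfolding bond_fraction_eq_def foc_def x_def[symmetric] by auto
qed

text \<open>The term with \<open>h\<close> decreases strictly and the term with \<open>b\<close>
  weakly, since its difference quotient has the sign of \<open>b * x\<^sup>2\<close>.\<close>

lemma foc_strict_decreasing:
  assumes "h > 0" "b \<le> 0" and pq: "p < q" "q < 1" and p: "0 < 1 + p * x" and q: "0 < 1 + q * x"
  shows "foc \<theta> h b x q < foc \<theta> h b x p"
proof -
  have "h / (1 - p) < h / (1 - q)"
    using assms by (intro divide_strict_left_mono) auto
  moreover have "b * x / (1 + p * x) \<le> b * x / (1 + q * x)"
  proof -
    have "b * x / (1 + q * x) - b * x / (1 + p * x) = - b * x\<^sup>2 * (q - p) / ((1 + q * x) * (1 + p * x))"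
      using p q by (simp add: divide_simps) (simp add: algebra_simps power2_eq_square)
    moreover have "0 \<le> \<dots>"
      using assms by (intro divide_nonneg_pos mult_nonneg_nonneg) auto
    ultimately show ?thesis by linarith
  qed
  ultimately show ?thesis unfolding foc_def by simp
qed

text \<open>Clearing denominators gives a quadratic in \<open>p\<close>, linear if
  \<open>\<theta> = 0\<close>. Its slope at an admissible root is nonnegative, so the slope equals
  the nonnegative square root of the discriminant.\<close>

lemma foc_root:
  assumes h: "h > 0" and b: "b \<le> 0" and x: "x \<noteq> 0" and p: "p < 1" "0 < 1 + p * x"
    and root: "foc \<theta> h b x p = 0"
  shows "p = (if \<theta> = 0 then - ((h + b * x) / ((h - b) * x))
     else ((b - h) * x + \<theta> * (x - 1)
       + sqrt (- 4 * \<theta> * x * (h - \<theta> + b * x) + (\<theta> - b * x + h * x - \<theta> * x)\<^sup>2)) / (2 * \<theta> * x))"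
proof -
  \<comment> \<open>The coefficient of \<open>p\<close> in the quadratic. Its negative is the part
    of the numerator outside the root, and the radicand is the discriminant.\<close>
  define B where "B = \<theta> - b * x + h * x - \<theta> * x"
  have "foc \<theta> h b x p * ((1 - p) * (1 + p * x)) =
      \<theta> * ((1 - p) * (1 + p * x)) - h * (1 + p * x) - b * x * (1 - p)"
  proof -
    have "h / (1 - p) * ((1 - p) * (1 + p * x)) = h * (1 + p * x)"
      "b * x / (1 + p * x) * ((1 - p) * (1 + p * x)) = b * x * (1 - p)"
      using p by (auto simp: divide_simps)
    then show ?thesis unfolding foc_def left_diff_distrib by simp
  qed
  then have quad: "\<theta> * x * p\<^sup>2 + B * p + (h + b * x - \<theta>) = 0"
    unfolding root B_def by (simp add: algebra_simps power2_eq_square)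
  show ?thesis
  proof (cases "\<theta> = 0")
    case True
    have "p * ((h - b) * x) = - (h + b * x)"
      using quad unfolding True B_def by (simp add: algebra_simps)
    then show ?thesis using True h b x by (simp add: minus_divide_left eq_divide_eq)
  next
    case False
    have disc: "(2 * \<theta> * x * p + B)\<^sup>2 = - 4 * \<theta> * x * (h - \<theta> + b * x) + B\<^sup>2"
    proof -
      have "(2 * \<theta> * x * p + B)\<^sup>2 =
          4 * \<theta> * x * (\<theta> * x * p\<^sup>2 + B * p + (h + b * x - \<theta>)) - 4 * \<theta> * x * (h - \<theta> + b * x) + B\<^sup>2"
        by (simp add: algebra_simps power2_eq_square)
      then show ?thesis unfolding quad by simp
    qed
    \<comment> \<open>This is the slope of the quadratic at \<open>p\<close>. Inserting \<theta>
      from the equation makes it a sum of nonnegative terms, whatever the sign of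
      \<open>\<theta> * x\<close>; hence the plus sign in all cases.\<close>
    have sign: "0 \<le> 2 * \<theta> * x * p + B"
    proof -
      have th: "\<theta> = h / (1 - p) + b * x / (1 + p * x)" using root by (simp add: foc_def)
      have "2 * \<theta> * x * p + B = \<theta> * ((1 + p * x) - x * (1 - p)) + (h - b) * x"
        by (simp add: B_def algebra_simps)
      also have "\<dots> = h * (1 + p * x) / (1 - p) - b * x\<^sup>2 * (1 - p) / (1 + p * x)"
        unfolding th using p by (simp add: divide_simps) (simp add: algebra_simps power2_eq_square)
      also have "\<dots> \<ge> 0"
      proof -
        have "0 \<le> h * (1 + p * x) / (1 - p)" using h p by simp
        moreover have "b * x\<^sup>2 * (1 - p) / (1 + p * x) \<le> 0"
          using b p by (intro divide_nonpos_pos mult_nonpos_nonneg) auto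
        ultimately show ?thesis by linarith
      qed
      finally show ?thesis .
    qed
    have "sqrt (- 4 * \<theta> * x * (h - \<theta> + b * x) + B\<^sup>2) = 2 * \<theta> * x * p + B"
      unfolding disc[symmetric] using sign by simp
    then show ?thesis using False x unfolding B_def[symmetric]
      by (simp add: eq_divide_eq) (simp add: B_def algebra_simps)
  qed
qed

text \<open>The root is trapped between \<open>p \<plusminus> e\<close> because the equation changes sign there, and keeps
  doing so under small changes of the coefficients.\<close>

lemma foc_root_continuous:
  fixes \<theta> x p :: "real \<Rightarrow> real"
  assumes "h > 0" "b \<le> 0" and cont: "continuous_on S \<theta>" "continuous_on S x"
    and root: "\<And>t. t \<in> S \<Longrightarrow> p t < 1 \<and> 0 < 1 + p t * x t \<and> foc (\<theta> t) h b (x t) (p t) = 0"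
  shows "continuous_on S p"
  unfolding continuous_on
proof
  fix t assume t: "t \<in> S"
  have lim: "(\<theta> \<longlongrightarrow> \<theta> t) (at t within S)" "(x \<longlongrightarrow> x t) (at t within S)"
    using cont t by (auto simp: continuous_on)
  have limfoc: "((\<lambda>s. foc (\<theta> s) h b (x s) r) \<longlongrightarrow> foc (\<theta> t) h b (x t) r) (at t within S)"
    if "r < 1" "0 < 1 + r * x t" for r
    unfolding foc_def using that by (intro tendsto_intros lim) auto
  have limdom: "\<forall>\<^sub>F s in at t within S. 0 < 1 + r * x s" if "0 < 1 + r * x t" for r
    by (rule order_tendstoD(1)[OF _ that]) (intro tendsto_intros lim)
  have in_S: "\<forall>\<^sub>F s in at t within S. s \<in> S"
    by (auto simp: eventually_at_filter)
  \<comment> \<open>The admissible domain is open, so test points exist arbitrarily close to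
    \<open>p t\<close>.\<close>
  have nearby: "\<exists>r. l < r \<and> r < p t \<and> 0 < 1 + r * x t" if "l < p t" for l
  proof -
    have "((\<lambda>r. 1 + r * x t) \<longlongrightarrow> 1 + p t * x t) (at_left (p t))" by (intro tendsto_intros)
    then have "\<forall>\<^sub>F r in at_left (p t). 0 < 1 + r * x t" using root[OF t] by (auto dest: order_tendstoD(1))
    moreover have "\<forall>\<^sub>F r in at_left (p t). r \<in> {l<..<p t}" using that by (rule eventually_at_left_real)
    ultimately have "\<forall>\<^sub>F r in at_left (p t). l < r \<and> r < p t \<and> 0 < 1 + r * x t"
      by eventually_elim auto
    then show ?thesis by (rule eventually_happens'[rotated]) simp
  qed
  have nearby': "\<exists>r. p t < r \<and> r < u \<and> r < 1 \<and> 0 < 1 + r * x t" if "p t < u" for u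
  proof -
    have "((\<lambda>r. 1 + r * x t) \<longlongrightarrow> 1 + p t * x t) (at_right (p t))" by (intro tendsto_intros)
    then have "\<forall>\<^sub>F r in at_right (p t). 0 < 1 + r * x t" using root[OF t] by (auto dest: order_tendstoD(1))
    moreover have "\<forall>\<^sub>F r in at_right (p t). r \<in> {p t<..<min u 1}"
      using that root[OF t] by (intro eventually_at_right_real) auto
    ultimately have "\<forall>\<^sub>F r in at_right (p t). p t < r \<and> r < u \<and> r < 1 \<and> 0 < 1 + r * x t"
      by eventually_elim auto
    then show ?thesis by (rule eventually_happens'[rotated]) simp
  qed
  show "(p \<longlongrightarrow> p t) (at t within S)"
  proof (rule order_tendstoI)
    fix l assume "l < p t"
    then obtain r where r: "l < r" "r < p t" "0 < 1 + r * x t" using nearby by blast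
    have "0 < foc (\<theta> t) h b (x t) r"
      using foc_strict_decreasing[OF assms(1,2) r(2) _ r(3), of "\<theta> t"] root[OF t] by simp
    then have "\<forall>\<^sub>F s in at t within S. 0 < foc (\<theta> s) h b (x s) r"
      using limfoc[of r] r root[OF t] by (auto dest: order_tendstoD(1))
    then show "\<forall>\<^sub>F s in at t within S. l < p s"
      using limdom[OF r(3)] in_S
    proof eventually_elim
      case (elim s)
      \<comment> \<open>If \<open>p s \<le> r\<close>, monotonicity would bound the value at
        \<open>r\<close> by the value 0 at \<open>p s\<close>, against its positivity.\<close>
      have "\<not> p s \<le> r"
      proof
        assume "p s \<le> r"
        then have "foc (\<theta> s) h b (x s) r \<le> foc (\<theta> s) h b (x s) (p s)"
          using foc_strict_decreasing[OF assms(1,2), of "p s" r "x s" "\<theta> s"] r root[OF t] root[OF elim(3)] elim(2)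
          by (cases "p s = r") auto
        then show False using elim(1) root[OF elim(3)] by simp
      qed
      then show ?case using r by simp
    qed
  next
    fix u assume "p t < u"
    then obtain r where r: "p t < r" "r < u" "r < 1" "0 < 1 + r * x t" using nearby' by blast
    have "foc (\<theta> t) h b (x t) r < 0"
      using foc_strict_decreasing[OF assms(1,2) r(1,3) _ r(4), of "\<theta> t"] root[OF t] by simp
    then have "\<forall>\<^sub>F s in at t within S. foc (\<theta> s) h b (x s) r < 0"
      using limfoc[of r] r by (auto dest: order_tendstoD(2))
    then show "\<forall>\<^sub>F s in at t within S. p s < u"
      using limdom[OF r(4)] in_S
    proof eventually_elim
      case (elim s)
      have "\<not> r \<le> p s"
      proof
        assume "r \<le> p s"
        then have "foc (\<theta> s) h b (x s) (p s) \<le> foc (\<theta> s) h b (x s) r"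
          using foc_strict_decreasing[OF assms(1,2), of r "p s" "x s" "\<theta> s"] root[OF elim(3)] elim(2)
          by (cases "p s = r") auto
        then show False using elim(1) root[OF elim(3)] by simp
      qed
      then show ?case using r by simp
    qed
  qed
qed

section \<open>Measurability of path integrals and mixtures of measures\<close>

text \<open>The events of \<open>generated_events\<close> as a measure space, so that measurability
  of functions can be expressed; only its space and sets matter.\<close>

definition path_algebra :: "'w measure \<Rightarrow> (real \<Rightarrow> 'w \<Rightarrow> nat) \<Rightarrow> real set \<Rightarrow> 'w measure" where
  "path_algebra M X I = sigma (space M) {X u -` {j} \<inter> space M | u j. u \<in> I \<and> j \<in> {1,2}}"

lemma space_path_algebra [simp]: "space (path_algebra M X I) = space M"
  unfolding path_algebra_def by (rule space_measure_of) auto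

lemma sets_path_algebra: "sets (path_algebra M X I) = generated_events M X I"
  unfolding path_algebra_def generated_events_def by (rule sets_measure_of) auto

lemma measurable_path_algebra:
  assumes "u \<in> I" and X: "X u \<in> M \<rightarrow>\<^sub>M count_space {1,2}"
  shows "X u \<in> path_algebra M X I \<rightarrow>\<^sub>M count_space {1,2}"
proof (rule measurable_count_space_eq2[THEN iffD2])
  show "X u \<in> space (path_algebra M X I) \<rightarrow> {1, 2} \<and>
    (\<forall>j\<in>{1, 2}. X u -` {j} \<inter> space (path_algebra M X I) \<in> sets (path_algebra M X I))"
    using measurable_space[OF X] assms(1)
    by (auto simp: sets_path_algebra generated_events_def intro!: sigma_sets.Basic)
qed simp

lemma subalgebra_path_algebra:
  assumes X: "\<And>u. u \<in> I \<Longrightarrow> X u \<in> M \<rightarrow>\<^sub>M count_space {1,2}"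
  shows "subalgebra M (path_algebra M X I)"
  unfolding subalgebra_def sets_path_algebra generated_events_def
proof
  show "sigma_sets (space M) {X u -` {j} \<inter> space M |u j. u \<in> I \<and> j \<in> {1, 2}} \<subseteq> sets M"
    using measurable_sets[OF X] by (intro sets.sigma_sets_subset) auto
qed simp

text \<open>\<open>N\<close> is kept general because the Markov property needs measurability with
  respect to the path algebra of the future, which is finer information than measurability in
  \<open>M\<close>. Right-continuity gives joint measurability in time and path, and integrating out
  time preserves measurability.\<close>

lemma integral_right_continuous_path:
  fixes N :: "'w measure" and Y :: "real \<Rightarrow> 'w \<Rightarrow> nat" and f :: "nat \<Rightarrow> real" and t T :: real
  assumes "t \<le> T"
    and Y: "\<And>s. s \<in> {t..T} \<Longrightarrow> Y s \<in> N \<rightarrow>\<^sub>M count_space {1,2}"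
    and right_cont: "\<And>\<omega> s. \<omega> \<in> space N \<Longrightarrow> s \<in> {t..<T} \<Longrightarrow> \<forall>\<^sub>F u in at_right s. Y u \<omega> = Y s \<omega>"
  shows "(\<lambda>\<omega>. integral {t..T} (\<lambda>s. f (Y s \<omega>))) \<in> borel_measurable N"
    and "\<And>\<omega>. \<omega> \<in> space N \<Longrightarrow> (\<lambda>s. f (Y s \<omega>)) integrable_on {t..T}"
proof -
  define C where "C = \<bar>f 1\<bar> + \<bar>f 2\<bar>"
  have val: "Y s \<omega> \<in> {1,2}" if "s \<in> {t..T}" "\<omega> \<in> space N" for s \<omega>
    using measurable_space[OF Y] that by auto
  \<comment> \<open>Clipped to \<open>[t,T]\<close>, the grid point \<open>(\<lfloor>s n\<rfloor> + 1) / n\<close> lies strictly to the right of \<open>s\<close>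
    and tends to \<open>s\<close>, so sampling there approximates \<open>Y\<close> by jointly measurable functions.\<close>
  define q where "q k n = max t (min T ((real_of_int k + 1) / real (Suc n)))" for k :: int and n
  have q: "q k n \<in> {t..T}" for k n using \<open>t \<le> T\<close> by (auto simp: q_def)
  \<comment> \<open>The interval is half-open because right-continuity is available only before
    \<open>T\<close>; the point \<open>T\<close> is restored in \<open>hk\<close>.\<close>
  define Z where "Z = (\<lambda>(s, \<omega>). indicator {t..<T} s * f (Y s \<omega>))"
  have meas: "Z \<in> borel_measurable (lborel \<Otimes>\<^sub>M N)"
  proof (rule borel_measurable_LIMSEQ_metric)
    fix n
    have [measurable]: "(\<lambda>\<omega>. f (Y (q k n) \<omega>)) \<in> borel_measurable N" for k
      by (rule measurable_compose[OF Y[OF q]]) simp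
    \<comment> \<open>The floor takes countably many values, and for each of them the sample is
      measurable in the path.\<close>
    have "(\<lambda>z. f (Y (q \<lfloor>fst z * real (Suc n)\<rfloor> n) (snd z))) \<in> borel_measurable (lborel \<Otimes>\<^sub>M N)"
      by (rule measurable_compose_countable) measurable
    then show "(\<lambda>z :: real \<times> 'w. indicator {t..<T} (fst z) * f (Y (q \<lfloor>fst z * real (Suc n)\<rfloor> n) (snd z)))
        \<in> borel_measurable (lborel \<Otimes>\<^sub>M N)"
      by measurable
  next
    fix z :: "real \<times> 'w" assume z: "z \<in> space (lborel \<Otimes>\<^sub>M N)"
    obtain s \<omega> where sw: "z = (s, \<omega>)" "\<omega> \<in> space N" using z by (auto simp: space_pair_measure)
    show "(\<lambda>n. indicator {t..<T} (fst z) * f (Y (q \<lfloor>fst z * real (Suc n)\<rfloor> n) (snd z))) \<longlonglongrightarrow> Z z"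
    proof (cases "s \<in> {t..<T}")
      case True
      have "\<forall>\<^sub>F n in sequentially. Y (q \<lfloor>s * real (Suc n)\<rfloor> n) \<omega> = Y s \<omega>"
      proof -
        obtain u where u: "u > s" "\<And>v. s < v \<Longrightarrow> v < u \<Longrightarrow> Y v \<omega> = Y s \<omega>"
          using right_cont[OF sw(2) True] unfolding eventually_at_right_field by auto
        have "\<forall>\<^sub>F n in sequentially. inverse (real (Suc n)) < min u T - s"
          using LIMSEQ_inverse_real_of_nat u(1) True by (intro order_tendstoD(2)) auto
        then show ?thesis
        proof eventually_elim
          case (elim n)
          \<comment> \<open>The unclipped grid point. It exceeds \<open>s\<close> by at most
            \<open>1 / (n + 1)\<close>, which keeps it below \<open>u\<close> and \<open>T\<close>,
            so clipping does not change it.\<close>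
          define r where "r = (real_of_int \<lfloor>s * real (Suc n)\<rfloor> + 1) / real (Suc n)"
          have "s < r"
            unfolding r_def by (subst pos_less_divide_eq) linarith+
          moreover have "r \<le> s + inverse (real (Suc n))"
          proof -
            have "r \<le> (s * real (Suc n) + 1) / real (Suc n)"
              unfolding r_def by (intro divide_right_mono) auto
            then show ?thesis by (simp add: add_divide_distrib inverse_eq_divide)
          qed
          ultimately have "q \<lfloor>s * real (Suc n)\<rfloor> n = r" "r < u"
            using elim True unfolding q_def r_def[symmetric] by auto
          then show ?case using u(2) \<open>s < r\<close> by simp
        qed
      qed
      then have "\<forall>\<^sub>F n in sequentially.
          indicator {t..<T} (fst z) * f (Y (q \<lfloor>fst z * real (Suc n)\<rfloor> n) (snd z)) = Z z"
        by (rule eventually_mono) (simp add: Z_def sw)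
      then show ?thesis by (rule tendsto_eventually)
    qed (simp add: Z_def sw)
  qed
  have bound: "\<bar>Z (s, \<omega>)\<bar> \<le> C * indicator {t..T} s" if "\<omega> \<in> space N" for s \<omega>
    using val[OF _ that, of s] by (auto simp: Z_def C_def indicator_def)
  have int: "integrable lborel (\<lambda>s. Z (s, \<omega>))" if w: "\<omega> \<in> space N" for \<omega>
  proof (rule Bochner_Integration.integrable_bound)
    show "integrable lborel (\<lambda>s. C * indicator {t..T} s :: real)"
      using \<open>t \<le> T\<close> by (intro integrable_mult_right integrable_real_indicator) auto
    show "(\<lambda>s. Z (s, \<omega>)) \<in> borel_measurable lborel"
      using measurable_compose[OF measurable_Pair2'[OF w] meas] by simp
    have "C \<ge> 0" by (simp add: C_def)
    then show "AE s in lborel. norm (Z (s, \<omega>)) \<le> norm (C * indicator {t..T} s :: real)"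
      using bound[OF w] by (simp add: abs_mult)
  qed
  \<comment> \<open>Passage from the Lebesgue integral of \<open>Z\<close> to the gauge integral; on
    \<open>{t..T}\<close> the integrands differ at most at \<open>T\<close>.\<close>
  have hk: "((\<lambda>s. f (Y s \<omega>)) has_integral (\<integral>s. Z (s, \<omega>) \<partial>lborel)) {t..T}" if w: "\<omega> \<in> space N" for \<omega>
  proof -
    have "((\<lambda>s. Z (s, \<omega>)) has_integral (\<integral>s. Z (s, \<omega>) \<partial>lborel)) UNIV"
      by (rule has_integral_integral_lborel[OF int[OF w]])
    then have "((\<lambda>s. Z (s, \<omega>)) has_integral (\<integral>s. Z (s, \<omega>) \<partial>lborel)) {t..T}"
      by (subst has_integral_restrict_UNIV[symmetric], rule has_integral_eq[rotated]) (auto simp: Z_def)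
    then show ?thesis
      by (rule has_integral_spike_finite[of "{T}", rotated 2]) (auto simp: Z_def)
  qed
  show "(\<lambda>s. f (Y s \<omega>)) integrable_on {t..T}" if "\<omega> \<in> space N" for \<omega>
    using hk[OF that] by blast
  have "(\<lambda>\<omega>. \<integral>s. Z (s, \<omega>) \<partial>lborel) \<in> borel_measurable N"
    using meas by (intro lborel.borel_measurable_lebesgue_integral)
      (auto simp: case_prod_unfold intro!: measurable_compose[OF _ meas])
  then show "(\<lambda>\<omega>. integral {t..T} (\<lambda>s. f (Y s \<omega>))) \<in> borel_measurable N"
    by (rule measurable_cong[THEN iffD1, rotated]) (rule integral_unique[OF hk, symmetric])
qed

text \<open>Extends an identity between measures from events to bounded functions, by induction over
  nonnegative measurable functions. The identity is known only on the sub-algebra \<open>N\<close>,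
  so \<open>f\<close> has to be measurable there.\<close>

lemma finite_mixture_integral:
  fixes f :: "'w \<Rightarrow> real"
  assumes I: "finite I" and p: "\<And>j. j \<in> I \<Longrightarrow> 0 \<le> p j"
    and P: "prob_space P" "subalgebra P N"
    and Q: "\<And>j. j \<in> I \<Longrightarrow> prob_space (Q j)" "\<And>j. j \<in> I \<Longrightarrow> subalgebra (Q j) N"
    and mix: "\<And>B. B \<in> sets N \<Longrightarrow> measure P B = (\<Sum>j\<in>I. p j * measure (Q j) B)"
    and f: "f \<in> borel_measurable N" "\<And>x. 0 \<le> f x" "\<And>x. f x \<le> C"
  shows "(\<integral>x. f x \<partial>P) = (\<Sum>j\<in>I. p j * (\<integral>x. f x \<partial>Q j))"
proof -
  have meas: "u \<in> borel_measurable P" "j \<in> I \<Longrightarrow> u \<in> borel_measurable (Q j)"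
    if "u \<in> borel_measurable N" for u :: "'w \<Rightarrow> ennreal" and j
    using measurable_from_subalg[OF P(2) that] measurable_from_subalg[OF Q(2) that] by auto
  have setsP: "B \<in> sets P" "j \<in> I \<Longrightarrow> B \<in> sets (Q j)" if "B \<in> sets N" for B j
    using that P(2) Q(2) by (auto simp: subalgebra_def)
  have spaces: "space P = space N" "j \<in> I \<Longrightarrow> space (Q j) = space N" for j
    using P(2) Q(2) by (auto simp: subalgebra_def)
  have nn: "(\<integral>\<^sup>+x. u x \<partial>P) = (\<Sum>j\<in>I. ennreal (p j) * (\<integral>\<^sup>+x. u x \<partial>Q j))"
    if "u \<in> borel_measurable N" for u
    using that
  proof (induction rule: borel_measurable_induct)
    case (cong f g)
    have "(\<integral>\<^sup>+x. f x \<partial>P) = (\<integral>\<^sup>+x. g x \<partial>P)"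
      using cong(3) by (intro nn_integral_cong) (simp add: spaces)
    moreover have "(\<integral>\<^sup>+x. f x \<partial>Q j) = (\<integral>\<^sup>+x. g x \<partial>Q j)" if "j \<in> I" for j
      using cong(3) that by (intro nn_integral_cong) (simp add: spaces)
    ultimately show ?case using cong(4) by simp
  next
    case (set A)
    have "emeasure P A = (\<Sum>j\<in>I. ennreal (p j) * emeasure (Q j) A)"
      using mix[OF set] p Q(1) P(1)
      by (simp add: finite_measure.emeasure_eq_measure prob_space.finite_measure ennreal_mult
          flip: sum_ennreal cong: sum.cong)
    then show ?case using setsP[OF set] by simp
  next
    case (mult u c)
    then show ?case
      by (simp add: nn_integral_cmult meas sum_distrib_left mult.left_commute cong: sum.cong)
  next
    case (add u v)
    then show ?case
      by (simp add: nn_integral_add meas distrib_left sum.distrib cong: sum.cong)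
  next
    case (seq U)
    \<comment> \<open>Monotonicity of each summand lets the supremum pass through the finite
      sum.\<close>
    have mono: "incseq (\<lambda>i. ennreal (p j) * (\<integral>\<^sup>+x. U i x \<partial>Q j))" for j
      using seq(3) by (auto simp: incseq_def le_fun_def intro!: mult_left_mono nn_integral_mono)
    have "(\<integral>\<^sup>+x. (SUP i. U i) x \<partial>P) = (SUP i. \<integral>\<^sup>+x. U i x \<partial>P)"
      unfolding SUP_apply using seq by (intro nn_integral_monotone_convergence_SUP meas)
    also have "\<dots> = (SUP i. \<Sum>j\<in>I. ennreal (p j) * (\<integral>\<^sup>+x. U i x \<partial>Q j))"
      using seq.IH by simp
    also have "\<dots> = (\<Sum>j\<in>I. SUP i. ennreal (p j) * (\<integral>\<^sup>+x. U i x \<partial>Q j))"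
      by (rule ennreal_SUP_sum) (rule mono)
    also have "\<dots> = (\<Sum>j\<in>I. ennreal (p j) * (\<integral>\<^sup>+x. (SUP i. U i) x \<partial>Q j))"
      unfolding SUP_apply SUP_mult_left_ennreal[symmetric] using seq
      by (intro sum.cong refl) (simp add: nn_integral_monotone_convergence_SUP meas)
    finally show ?case .
  qed
  have bounded: "integrable S f" if "prob_space S" "subalgebra S N" for S
  proof -
    interpret prob_space S by fact
    show ?thesis
      by (rule integrable_const_bound[of _ C]) (use f(2,3) measurable_from_subalg[OF that(2) f(1)] in auto)
  qed
  note fin = bounded[OF P] bounded[OF Q]
  have "ennreal (\<integral>x. f x \<partial>P) = (\<Sum>j\<in>I. ennreal (p j) * ennreal (\<integral>x. f x \<partial>Q j))"
    using nn[of "\<lambda>x. ennreal (f x)"] f fin by (simp add: nn_integral_eq_integral cong: sum.cong)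
  also have "\<dots> = ennreal (\<Sum>j\<in>I. p j * (\<integral>x. f x \<partial>Q j))"
    using p f(2) by (simp add: ennreal_mult flip: sum_ennreal cong: sum.cong)
  finally show ?thesis
    by (subst (asm) ennreal_inj) (auto intro!: sum_nonneg mult_nonneg_nonneg Bochner_Integration.integral_nonneg p f)
qed

section \<open>The Markov property and transition probabilities\<close>

lemma markov_familyD:
  assumes "markov_family M T Pr X G"
  shows "t \<in> {0..T} \<Longrightarrow> X t \<in> M \<rightarrow>\<^sub>M count_space {1,2}"
    and "\<omega> \<in> space M \<Longrightarrow> t \<in> {0..<T} \<Longrightarrow> \<forall>\<^sub>F u in at_right t. X u \<omega> = X t \<omega>"
    and "s \<in> {0..T} \<Longrightarrow> i \<in> {1,2} \<Longrightarrow> prob_space (Pr s i)"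
    and "s \<in> {0..T} \<Longrightarrow> i \<in> {1,2} \<Longrightarrow> sets (Pr s i) = sets M"
    and "s \<in> {0..T} \<Longrightarrow> i \<in> {1,2} \<Longrightarrow> AE \<omega> in Pr s i. X s \<omega> = i"
    and "s \<in> {0..T} \<Longrightarrow> t \<in> {s..T} \<Longrightarrow> i \<in> {1,2} \<Longrightarrow> j \<in> {1,2} \<Longrightarrow>
      A \<in> generated_events M X {s..t} \<Longrightarrow> B \<in> generated_events M X {t..T} \<Longrightarrow>
      measure (Pr s i) (A \<inter> {\<omega>\<in>space M. X t \<omega> = j} \<inter> B) =
      measure (Pr s i) (A \<inter> {\<omega>\<in>space M. X t \<omega> = j}) * measure (Pr t j) B"
    and "s \<in> {0..T} \<Longrightarrow> t \<in> {s..T} \<Longrightarrow> i \<in> {1,2} \<Longrightarrow> j \<in> {1,2} \<Longrightarrow>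
      ((\<lambda>u. measure (Pr s i) {\<omega>\<in>space M. X u \<omega> = j}) has_real_derivative
         (\<Sum>k\<in>{1,2}. measure (Pr s i) {\<omega>\<in>space M. X t \<omega> = k} * G t k j)) (at t within {s..T})"
  using assms unfolding markov_family_def cadlag_path_def by blast+

lemma markov_family_subalgebra:
  assumes "markov_family M T Pr X G" "0 \<le> t" "s \<in> {0..T}" "i \<in> {1,2}"
  shows "subalgebra (Pr s i) (path_algebra M X {t..T})"
  using subalgebra_path_algebra[of "{t..T}" X M] markov_familyD(1)[OF assms(1)]
    markov_familyD(4)[OF assms(1,3,4)] assms(2)
  by (auto simp: subalgebra_def dest: sets_eq_imp_space_eq)

lemma markov_family_state_sets:
  assumes "markov_family M T Pr X G" "t \<in> {0..T}"
  shows "{\<omega>\<in>space M. X t \<omega> = j} \<in> sets M"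
proof (cases "j \<in> {1,2}")
  case True
  have "{\<omega>\<in>space M. X t \<omega> = j} = X t -` {j} \<inter> space M" by auto
  then show ?thesis using measurable_sets[OF markov_familyD(1)[OF assms], of "{j}"] True by simp
next
  case False
  then have "{\<omega>\<in>space M. X t \<omega> = j} = {}"
    using measurable_space[OF markov_familyD(1)[OF assms]] by auto
  then show ?thesis by (simp only: sets.empty_sets)
qed

text \<open>The Markov property with the whole space as past event, summed over the state at time
  \<open>t\<close>.\<close>

lemma markov_family_mixture:
  assumes fam: "markov_family M T Pr X G" and s: "s \<in> {0..T}" and t: "t \<in> {s..T}" and i: "i \<in> {1,2}"
    and B: "B \<in> generated_events M X {t..T}"
  shows "measure (Pr s i) B =
     (\<Sum>j\<in>{1,2}. measure (Pr s i) {\<omega>\<in>space M. X t \<omega> = j} * measure (Pr t j) B)"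
proof -
  interpret prob_space "Pr s i" by (rule markov_familyD(3)[OF fam s i])
  have t': "t \<in> {0..T}" using s t by auto
  have top: "space M \<in> generated_events M X {s..t}"
    unfolding generated_events_def by (rule sigma_sets_top)
  have setsB: "B \<in> sets (Pr s i)"
    using B markov_family_subalgebra[OF fam _ s i, of t] t'
    by (auto simp: subalgebra_def sets_path_algebra)
  have BM: "B \<subseteq> space M" using sets.sets_into_space[OF setsB] markov_familyD(4)[OF fam s i]
    by (auto dest: sets_eq_imp_space_eq)
  let ?E = "\<lambda>j. {\<omega>\<in>space M. X t \<omega> = j}"
  have E: "?E j \<in> sets (Pr s i)" for j
    using markov_family_state_sets[OF fam t'] markov_familyD(4)[OF fam s i] by simp
  have "B = (?E 1 \<inter> B) \<union> (?E 2 \<inter> B)"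
    using measurable_space[OF markov_familyD(1)[OF fam t']] BM by auto
  then have "measure (Pr s i) B = measure (Pr s i) ((?E 1 \<inter> B) \<union> (?E 2 \<inter> B))" by simp
  also have "\<dots> = measure (Pr s i) (?E 1 \<inter> B) + measure (Pr s i) (?E 2 \<inter> B)"
    using E setsB by (intro finite_measure_Union) auto
  also have "\<dots> = (\<Sum>j\<in>{1,2}. measure (Pr s i) (?E j \<inter> B))" by simp
  also have "\<dots> = (\<Sum>j\<in>{1,2}. measure (Pr s i) (?E j) * measure (Pr t j) B)"
  proof (rule sum.cong)
    fix j :: nat assume "j \<in> {1,2}"
    moreover have "space M \<inter> ?E j = ?E j" by auto
    ultimately show "measure (Pr s i) (?E j \<inter> B) = measure (Pr s i) (?E j) * measure (Pr t j) B"
      using markov_familyD(6)[OF fam s t i _ top B, of j] by simp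
  qed simp
  finally show ?thesis .
qed

text \<open>The probability of the other state starts at 0. By the forward equation its derivative
  is a sum of two terms, each a probability times a rate of size at most \<open>B\<close>; hence the
  constant \<open>2 * B\<close>.\<close>

lemma markov_family_leave_prob:
  assumes fam: "markov_family M T Pr X G" and s: "s \<in> {0..T}" and t: "t \<in> {s..T}" and i: "i \<in> {1,2}"
    and G: "\<And>t j k. t \<in> {0..T} \<Longrightarrow> j \<in> {1,2} \<Longrightarrow> k \<in> {1,2} \<Longrightarrow> \<bar>G t j k\<bar> \<le> B"
  shows "measure (Pr s i) {\<omega>\<in>space M. X t \<omega> = 3 - i} \<le> 2 * B * (t - s)"
proof -
  interpret prob_space "Pr s i" by (rule markov_familyD(3)[OF fam s i])
  define p where "p u j = measure (Pr s i) {\<omega>\<in>space M. X u \<omega> = j}" for u j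
  have j: "3 - i \<in> {1,2}" using i by auto
  have p: "0 \<le> p u k" "p u k \<le> 1" for u k by (auto simp: p_def)
  have "p s (3 - i) = 0"
  proof -
    have "AE \<omega> in Pr s i. \<omega> \<notin> {\<omega>\<in>space M. X s \<omega> = 3 - i}"
      using markov_familyD(5)[OF fam s i] by (rule AE_mp) (use i in auto)
    then have "{\<omega>\<in>space M. X s \<omega> = 3 - i} \<in> null_sets (Pr s i)"
      using markov_family_state_sets[OF fam s] markov_familyD(4)[OF fam s i]
      by (subst AE_iff_null_sets) auto
    then show ?thesis by (simp add: p_def measure_eq_0_null_sets)
  qed
  moreover have "norm (p t (3 - i) - p s (3 - i)) \<le> 2 * B * norm (t - s)"
  proof (rule field_differentiable_bound[of "{s..T}"])
    fix u assume u: "u \<in> {s..T}"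
    show "((\<lambda>u. p u (3 - i)) has_field_derivative (\<Sum>k\<in>{1,2}. p u k * G u k (3 - i))) (at u within {s..T})"
      unfolding p_def by (rule markov_familyD(7)[OF fam s u i j])
    have "\<bar>p u k * G u k (3 - i)\<bar> \<le> 1 * B" if "k \<in> {1,2}" for k
      unfolding abs_mult using p u s by (intro mult_mono G that j) auto
    from this[of 1] this[of 2] show "norm (\<Sum>k\<in>{1,2}. p u k * G u k (3 - i)) \<le> 2 * B" by simp
  qed (use t in auto)
  ultimately show ?thesis using t p(1)[of t "3 - i"] by (simp add: p_def)
qed

section \<open>Bounds and regularity of bond prices\<close>

text \<open>A path takes only the values 1 and 2, so \<open>C\<close> bounds the integrand; the
  second claim is additivity of the integral.\<close>

lemma discount_factor:
  fixes f :: "nat \<Rightarrow> real"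
  defines "C \<equiv> \<bar>f 1\<bar> + \<bar>f 2\<bar>"
  assumes fam: "markov_family M T Pr X G" and t: "t \<in> {0..T}" and \<omega>: "\<omega> \<in> space M"
  shows "\<bar>integral {t..T} (\<lambda>s. f (X s \<omega>))\<bar> \<le> C * (T - t)"
    and "s \<in> {0..t} \<Longrightarrow> \<bar>integral {s..T} (\<lambda>u. f (X u \<omega>)) - integral {t..T} (\<lambda>u. f (X u \<omega>))\<bar> \<le> C * (t - s)"
proof -
  have int: "(\<lambda>s. f (X s \<omega>)) integrable_on {u..T}" if "u \<in> {0..T}" for u
    using that markov_familyD(1,2)[OF fam] \<omega>
    by (intro integral_right_continuous_path(2)[of u T X M]) auto
  have bound: "\<bar>integral {u..v} (\<lambda>s. f (X s \<omega>))\<bar> \<le> C * (v - u)" if "0 \<le> u" "u \<le> v" "v \<le> T" for u v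
  proof -
    have "(\<lambda>s. f (X s \<omega>)) integrable_on {u..v}"
      using int[of u] that by (auto intro: integrable_subinterval_real)
    moreover have "\<bar>f (X s \<omega>)\<bar> \<le> C" if "s \<in> {u..v}" for s
      using measurable_space[OF markov_familyD(1)[OF fam, of s] \<omega>] that \<open>0 \<le> u\<close> \<open>v \<le> T\<close> by (auto simp: C_def)
    ultimately have "norm (integral (cbox u v) (\<lambda>s. f (X s \<omega>))) \<le> C * measure lborel (cbox u v)"
      by (intro integrable_bound) (auto simp: C_def)
    then show ?thesis using that by simp
  qed
  show "\<bar>integral {t..T} (\<lambda>s. f (X s \<omega>))\<bar> \<le> C * (T - t)" using bound t by simp
  show "\<bar>integral {s..T} (\<lambda>u. f (X u \<omega>)) - integral {t..T} (\<lambda>u. f (X u \<omega>))\<bar> \<le> C * (t - s)" if "s \<in> {0..t}"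
    using Henstock_Kurzweil_Integration.integral_combine[of s t T "\<lambda>u. f (X u \<omega>)"] int[of s] that t bound[of s t] by auto
qed

text \<open>The start \<open>s\<close> in the integrability claim is separate from \<open>t\<close>,
  because comparing prices at two times requires the discount factor from \<open>t\<close> on under
  the law started at \<open>s\<close>. The bounds are uniform in \<open>t\<close>.\<close>

lemma bond_price_expectation:
  fixes r h L :: "nat \<Rightarrow> real"
  defines "f \<equiv> \<lambda>j. r j + h j * L j"
  defines "C \<equiv> \<bar>f 1\<bar> + \<bar>f 2\<bar>"
  assumes fam: "markov_family M T Pr X G" and i: "i \<in> {1,2}" and t: "t \<in> {0..T}"
  defines "D \<equiv> \<lambda>t \<omega>. exp (- integral {t..T} (\<lambda>s. f (X s \<omega>)))"
  shows "D t \<in> borel_measurable (path_algebra M X {t..T})"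
    and "\<omega> \<in> space M \<Longrightarrow> exp (- C * T) \<le> D t \<omega> \<and> D t \<omega> \<le> exp (C * T)"
    and "s \<in> {0..T} \<Longrightarrow> integrable (Pr s i) (D t)"
    and "exp (- C * T) \<le> bond_price Pr X T r h L t i \<and> bond_price Pr X T r h L t i \<le> exp (C * T)"
proof -
  have "(\<lambda>\<omega>. integral {t..T} (\<lambda>s. f (X s \<omega>))) \<in> borel_measurable (path_algebra M X {t..T})"
    using t markov_familyD(1,2)[OF fam]
    by (intro integral_right_continuous_path(1) measurable_path_algebra) auto
  then show meas: "D t \<in> borel_measurable (path_algebra M X {t..T})"
    unfolding D_def by measurable
  show bounds: "exp (- C * T) \<le> D t \<omega> \<and> D t \<omega> \<le> exp (C * T)" if "\<omega> \<in> space M" for \<omega>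
  proof -
    have "C * (T - t) \<le> C * T" using t by (intro mult_left_mono) (auto simp: C_def)
    then show ?thesis
      using discount_factor(1)[OF fam t that, of f] unfolding C_def[symmetric] by (simp add: D_def abs_le_iff)
  qed
  show int: "integrable (Pr s i) (D t)" if s: "s \<in> {0..T}" for s
  proof -
    interpret prob_space "Pr s i" by (rule markov_familyD(3)[OF fam s i])
    have "space (Pr s i) = space M" using markov_familyD(4)[OF fam s i] by (rule sets_eq_imp_space_eq)
    then show ?thesis
      using bounds measurable_from_subalg[OF markov_family_subalgebra[OF fam _ s i] meas] t
      by (intro integrable_const_bound[of _ "exp (C * T)"]) (auto simp: D_def)
  qed
  interpret prob_space "Pr t i" by (rule markov_familyD(3)[OF fam t i])
  have "space (Pr t i) = space M" using markov_familyD(4)[OF fam t i] by (rule sets_eq_imp_space_eq)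
  then have "AE \<omega> in Pr t i. exp (- C * T) \<le> D t \<omega>" "AE \<omega> in Pr t i. D t \<omega> \<le> exp (C * T)"
    using bounds by auto
  then have "exp (- C * T) \<le> expectation (D t)" "expectation (D t) \<le> exp (C * T)"
    by (auto intro!: integral_ge_const integral_le_const int t)
  then show "exp (- C * T) \<le> bond_price Pr X T r h L t i \<and> bond_price Pr X T r h L t i \<le> exp (C * T)"
    by (simp add: bond_price_def D_def f_def)
qed

lemma bond_price_pos:
  assumes "markov_family M T Pr X G" "t \<in> {0..T}" "i \<in> {1,2}"
  shows "0 < bond_price Pr X T r h L t i"
  using bond_price_expectation(4)[OF assms(1,3,2), of r h L] by (rule conjunct1[THEN less_le_trans[OF exp_gt_zero]])

lemma bond_price_lipschitz:
  assumes fam: "markov_family M T Pr X G" and i: "i \<in> {1,2}"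
    and cont: "\<And>i j. i \<in> {1,2} \<Longrightarrow> j \<in> {1,2} \<Longrightarrow> continuous_on {0..T} (\<lambda>t. G t i j)"
  obtains K where "\<And>s t. s \<in> {0..T} \<Longrightarrow> t \<in> {s..T} \<Longrightarrow>
    \<bar>bond_price Pr X T r h L s i - bond_price Pr X T r h L t i\<bar> \<le> K * (t - s)"
proof -
  \<comment> \<open>A continuous rate is bounded on a compact interval; one bound has to serve all
    four entries.\<close>
  obtain B where B: "\<And>t j k. t \<in> {0..T} \<Longrightarrow> j \<in> {1,2} \<Longrightarrow> k \<in> {1,2} \<Longrightarrow> \<bar>G t j k\<bar> \<le> B"
  proof -
    have "\<exists>B. \<forall>t\<in>{0..T}. \<bar>G t j k\<bar> \<le> B" if "j \<in> {1,2}" "k \<in> {1,2}" for j k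
      using compact_imp_bounded[OF compact_continuous_image[OF cont[OF that] compact_Icc]]
      by (auto simp: bounded_iff)
    then obtain b where b: "\<And>j k t. j \<in> {1,2} \<Longrightarrow> k \<in> {1,2} \<Longrightarrow> t \<in> {0..T} \<Longrightarrow> \<bar>G t j k\<bar> \<le> b j k"
      by metis
    show ?thesis
    proof
      fix t and j k :: nat assume "t \<in> {0..T}" "j \<in> {1,2}" "k \<in> {1,2}"
      then show "\<bar>G t j k\<bar> \<le> \<bar>b 1 1\<bar> + \<bar>b 1 2\<bar> + \<bar>b 2 1\<bar> + \<bar>b 2 2\<bar>"
        using b[of j k t] by auto
    qed
  qed
  define f where "f = (\<lambda>j. r j + h j * L j)"
  define C where "C = \<bar>f 1\<bar> + \<bar>f 2\<bar>"
  define D where "D = (\<lambda>t \<omega>. exp (- integral {t..T} (\<lambda>s. f (X s \<omega>))))"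
  define e where "e = exp (C * T)"
  let ?V = "bond_price Pr X T r h L"
  have V: "?V t j = (\<integral>\<omega>. D t \<omega> \<partial>Pr t j)" for t j by (simp add: bond_price_def D_def f_def)
  note D = bond_price_expectation[OF fam, where r = r and h = h and L = L]
  have D2: "exp (- (C * T)) \<le> D t \<omega> \<and> D t \<omega> \<le> e" if "t \<in> {0..T}" "\<omega> \<in> space M" for t \<omega>
    using D(2)[OF i that] unfolding D_def e_def C_def f_def minus_mult_left .
  have D4: "0 < ?V t j \<and> ?V t j \<le> e" if "t \<in> {0..T}" "j \<in> {1,2}" for t j
    using D(4)[OF that(2,1)] less_le_trans[OF exp_gt_zero] unfolding e_def C_def f_def by blast
  have D3: "integrable (Pr s i) (D t)" if "s \<in> {0..T}" "t \<in> {0..T}" for s t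
    using D(3)[OF i that(2,1)] by (simp add: D_def f_def)
  have D1: "D t \<in> borel_measurable (path_algebra M X {t..T})" if "t \<in> {0..T}" for t
    using D(1)[OF i that] by (simp add: D_def f_def)
  \<comment> \<open>\<open>e * C\<close> accounts for replacing \<open>D s\<close> by
    \<open>D t\<close> under the law started at \<open>s\<close>; \<open>2 * B\<close> is the
    leaving rate, and \<open>2 * e\<close> bounds the price difference between the states.\<close>
  have "\<bar>?V s i - ?V t i\<bar> \<le> (e * C + 2 * B * (2 * e)) * (t - s)" if s: "s \<in> {0..T}" and t: "t \<in> {s..T}" for s t
  proof -
    have t': "t \<in> {0..T}" and st: "s \<in> {0..t}" using s t by auto
    interpret prob_space "Pr s i" by (rule markov_familyD(3)[OF fam s i])
    have sp: "space (Pr s i) = space M"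
      using markov_familyD(4)[OF fam s i] by (rule sets_eq_imp_space_eq)
    define p where "p j = measure (Pr s i) {\<omega>\<in>space M. X t \<omega> = j}" for j
    have "\<bar>D s \<omega> - D t \<omega>\<bar> \<le> e * (C * (t - s))" if w: "\<omega> \<in> space M" for \<omega>
    proof -
      let ?x = "- integral {s..T} (\<lambda>s. f (X s \<omega>))" and ?y = "- integral {t..T} (\<lambda>s. f (X s \<omega>))"
      \<comment> \<open>From \<open>1 + z \<le> exp z\<close> with \<open>z = v - u\<close>. The
        estimate is one-sided and is used in both directions.\<close>
      have le: "exp u - exp v \<le> e * (C * (t - s))"
        if "exp u \<le> e" "\<bar>u - v\<bar> \<le> C * (t - s)" for u v
      proof -
        have "exp u - exp v \<le> exp u * (u - v)"
          using exp_ge_add_one_self[of "v - u"] mult_left_mono[of "1 + (v - u)" "exp (v - u)" "exp u"]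
          by (simp add: exp_diff algebra_simps)
        also have "\<dots> \<le> exp u * \<bar>u - v\<bar>" by (intro mult_left_mono) auto
        also have "\<dots> \<le> e * (C * (t - s))"
          using that by (intro mult_mono) (auto simp: e_def)
        finally show ?thesis .
      qed
      have xy: "\<bar>?x - ?y\<bar> \<le> C * (t - s)"
        using discount_factor(2)[OF fam t' w st, of f] by (simp add: C_def)
      have "exp ?x \<le> e" "exp ?y \<le> e"
        using D2[OF s w] D2[OF t' w] by (auto simp: D_def)
      then have "exp ?x - exp ?y \<le> e * (C * (t - s))" "exp ?y - exp ?x \<le> e * (C * (t - s))"
        using xy by (intro le; simp add: abs_minus_commute)+
      then show ?thesis unfolding D_def by linarith
    qed
    then have "\<bar>\<integral>\<omega>. D s \<omega> - D t \<omega> \<partial>Pr s i\<bar> \<le> e * (C * (t - s))"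
      using integral_abs_bound[of "Pr s i" "\<lambda>\<omega>. D s \<omega> - D t \<omega>"]
        integral_le_const[of "\<lambda>\<omega>. \<bar>D s \<omega> - D t \<omega>\<bar>" "e * (C * (t - s))"] D3[OF s s] D3[OF s t'] sp
      by force
    then have first: "\<bar>?V s i - (\<integral>\<omega>. D t \<omega> \<partial>Pr s i)\<bar> \<le> e * (C * (t - s))"
      using D3[OF s s] D3[OF s t'] by (simp add: V)
    have mix: "(\<integral>\<omega>. D t \<omega> \<partial>Pr s i) = (\<Sum>j\<in>{1,2}. p j * ?V t j)"
    proof -
      \<comment> \<open>\<open>finite_mixture_integral\<close> wants a bound at every point, whereas
        \<open>D t\<close> is bounded by \<open>e\<close> only on \<open>space M\<close>; there the
        minimum changes nothing.\<close>
      let ?D' = "\<lambda>\<omega>. min (D t \<omega>) e"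
      have "(\<integral>\<omega>. ?D' \<omega> \<partial>Pr s i) = (\<Sum>j\<in>{1,2}. p j * (\<integral>\<omega>. ?D' \<omega> \<partial>Pr t j))"
      proof (rule finite_mixture_integral[where N = "path_algebra M X {t..T}" and C = e])
        show "measure (Pr s i) B = (\<Sum>j\<in>{1,2}. p j * measure (Pr t j) B)"
          if "B \<in> sets (path_algebra M X {t..T})" for B
          using markov_family_mixture[OF fam s t i, of B] that by (simp add: p_def sets_path_algebra)
        show "?D' \<in> borel_measurable (path_algebra M X {t..T})"
          using D1[OF t'] by measurable
      qed (use markov_familyD(3)[OF fam] markov_family_subalgebra[OF fam] s t' i in
          \<open>auto simp: p_def D_def e_def prob_space_axioms\<close>)
      moreover have "(\<integral>\<omega>. ?D' \<omega> \<partial>Pr u j) = (\<integral>\<omega>. D t \<omega> \<partial>Pr u j)" if "u \<in> {0..T}" "j \<in> {1,2}" for u j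
        using D2[OF t'] sets_eq_imp_space_eq[OF markov_familyD(4)[OF fam that]]
        by (intro Bochner_Integration.integral_cong) (auto simp: min_def)
      ultimately show ?thesis using s t' i by (simp add: V)
    qed
    \<comment> \<open>The mixture identity applied to the whole space.\<close>
    have p_sum: "p 1 + p 2 = 1"
    proof -
      have "space M \<in> generated_events M X {t..T}"
        unfolding generated_events_def by (rule sigma_sets_top)
      from markov_family_mixture[OF fam s t i this] show ?thesis
        using prob_space.prob_space[OF markov_familyD(3)[OF fam t']]
          sets_eq_imp_space_eq[OF markov_familyD(4)[OF fam t']] prob_space sp
        by (simp add: p_def)
    qed
    have j: "3 - i \<in> {1,2}" using i by auto
    have "(\<Sum>j\<in>{1,2}. p j * ?V t j) - ?V t i = p (3 - i) * (?V t (3 - i) - ?V t i)"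
    proof -
      have "p i = 1 - p (3 - i)" using p_sum i by force
      moreover have "(\<Sum>j\<in>{1,2}. p j * ?V t j) = p i * ?V t i + p (3 - i) * ?V t (3 - i)"
        using i by auto
      ultimately show ?thesis by (simp only:) (simp add: algebra_simps)
    qed
    moreover have "\<bar>p (3 - i) * (?V t (3 - i) - ?V t i)\<bar> \<le> (2 * B * (t - s)) * (2 * e)"
    proof -
      have "\<bar>?V t (3 - i) - ?V t i\<bar> \<le> 2 * e"
        using D4[OF t' i] D4[OF t' j] by linarith
      moreover have "0 \<le> p (3 - i)" "p (3 - i) \<le> 2 * B * (t - s)"
        using markov_family_leave_prob[OF fam s t i B] by (auto simp: p_def)
      ultimately show ?thesis unfolding abs_mult by (intro mult_mono) auto
    qed
    ultimately show ?thesis using first unfolding mix by (simp add: algebra_simps) linarith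
  qed
  then show ?thesis by (rule that)
qed

lemma bond_price_continuous:
  assumes "markov_family M T Pr X G" "i \<in> {1,2}"
    and "\<And>i j. i \<in> {1,2} \<Longrightarrow> j \<in> {1,2} \<Longrightarrow> continuous_on {0..T} (\<lambda>t. G t i j)"
  shows "continuous_on {0..T} (\<lambda>t. bond_price Pr X T r h L t i)"
proof -
  obtain K where K: "\<And>s t. s \<in> {0..T} \<Longrightarrow> t \<in> {s..T} \<Longrightarrow>
      \<bar>bond_price Pr X T r h L s i - bond_price Pr X T r h L t i\<bar> \<le> K * (t - s)"
    using bond_price_lipschitz[OF assms] by blast
  \<comment> \<open>A Lipschitz constant must be nonnegative, which is not known of
    \<open>K\<close>.\<close>
  have "\<bar>K\<bar>-lipschitz_on {0..T} (\<lambda>t. bond_price Pr X T r h L t i)"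
  proof (rule lipschitz_onI)
    have K': "\<bar>bond_price Pr X T r h L s i - bond_price Pr X T r h L t i\<bar> \<le> \<bar>K\<bar> * (t - s)"
      if "s \<in> {0..T}" "t \<in> {s..T}" for s t
      using K[OF that] mult_right_mono[OF abs_ge_self, of "t - s" K] that by auto
    fix s t assume "s \<in> {0..T}" "t \<in> {0..T}"
    then show "dist (bond_price Pr X T r h L s i) (bond_price Pr X T r h L t i) \<le> \<bar>K\<bar> * dist s t"
      using K'[of s t] K'[of t s] by (cases "s \<le> t") (auto simp: dist_real_def abs_minus_commute)
  qed simp
  then show ?thesis by (rule lipschitz_on_continuous_on)
qed

section \<open>The formulas in the market model\<close>

text \<open>Each formula is claimed where its denominators do not vanish, as division by zero yields
  0. The equivalences express existence and uniqueness at once. The claim on \<open>J\<close> takes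
  any solution \<open>K\<close> of the first system, so it also covers
  \<open>a 1 1 + a 2 2 = 0\<close>.\<close>

theorem corollary6p4:
  fixes M :: "'w measure" and P Q :: "real \<Rightarrow> nat \<Rightarrow> 'w measure" and X :: "real \<Rightarrow> 'w \<Rightarrow> nat"
    and T R :: real
    and a :: "nat \<Rightarrow> nat \<Rightarrow> real" and aQ \<kappa> :: "real \<Rightarrow> nat \<Rightarrow> nat \<Rightarrow> real"
    and r \<mu> \<sigma> h L \<eta> \<zeta> :: "nat \<Rightarrow> real"
    and \<psi> \<theta> \<psi>t \<pi> :: "real \<Rightarrow> nat \<Rightarrow> real"
  assumes horizon: "0 < R" "R \<le> T"
    and coefficients: "\<And>i. i \<in> {1,2} \<Longrightarrow> 0 < r i \<and> 0 < h i \<and> \<sigma> i \<noteq> 0"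
    and historical: "is_generator a" "markov_family M T P X (\<lambda>t. a)"
    and pricing: "markov_family M T Q X aQ"
    and equivalent: "\<And>s i. s \<in> {0..T} \<Longrightarrow> i \<in> {1,2} \<Longrightarrow>
          absolutely_continuous (P s i) (Q s i) \<and> absolutely_continuous (Q s i) (P s i)"
    and aQ_cont: "\<And>i j. i \<in> {1,2} \<Longrightarrow> j \<in> {1,2} \<Longrightarrow> continuous_on {0..T} (\<lambda>t. aQ t i j)"
    and aQ: "\<And>t i. t \<in> {0..T} \<Longrightarrow> i \<in> {1,2} \<Longrightarrow>
          aQ t i (3 - i) = a i (3 - i) * (1 + \<kappa> t i (3 - i)) \<and> aQ t i i = - aQ t i (3 - i)"
    and \<kappa>_gt: "\<And>t i. t \<in> {0..T} \<Longrightarrow> i \<in> {1,2} \<Longrightarrow> \<kappa> t i (3 - i) > -1"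
    and \<kappa>_meas: "\<And>i. i \<in> {1,2} \<Longrightarrow>
          (\<lambda>t. \<kappa> t i (3 - i)) \<in> borel_measurable (restrict_space borel {0..T})"
    and \<kappa>_bdd: "\<And>i. i \<in> {1,2} \<Longrightarrow> bounded ((\<lambda>t. \<kappa> t i (3 - i)) ` {0..T})"
    and \<eta>: "\<And>i. \<eta> i = (\<mu> i - r i) / \<sigma> i"
    and \<zeta>: "\<And>i. \<zeta> i = r i + (\<eta> i)^2 / 2"
    and \<psi>: "\<And>t i. \<psi> t i = bond_price Q X T r h L t i"
    and \<theta>: "\<And>t i. \<theta> t i = h i * L i - aQ t i (3 - i) * (\<psi> t (3 - i) / \<psi> t i - 1)"
    and \<psi>t: "\<And>t i. \<psi>t t i = \<psi> t (3 - i) / \<psi> t i - 1"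
    and fraction_exists: "\<And>t i. t \<in> {0..R} \<Longrightarrow> i \<in> {1,2} \<Longrightarrow> \<exists>!p. bond_fraction_eq a h \<theta> \<psi> t i p"
    and \<pi>: "\<And>t i. \<pi> t i = (THE p. bond_fraction_eq a h \<theta> \<psi> t i p)"
  shows "(a 1 1 + a 2 2 \<noteq> 0 \<longrightarrow>
           (\<forall>K. solves_K_system R a \<zeta> K \<longleftrightarrow>
                  (\<forall>t\<in>{0..R}. \<forall>i\<in>{1,2}. K t i = K_formula R a \<zeta> t i))) \<and>
         (\<forall>t\<in>{0..R}. \<forall>i\<in>{1,2}. \<psi>t t i \<noteq> 0 \<longrightarrow>
            \<pi> t i =
              (if \<theta> t i = 0 then - ((h i + a i i * \<psi>t t i) / ((h i - a i i) * \<psi>t t i))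
               else ((a i i - h i) * \<psi>t t i + \<theta> t i * (\<psi>t t i - 1) + sqrt (Delta a h \<theta> \<psi>t t i))
                      / (2 * \<theta> t i * \<psi>t t i))) \<and>
         (c_plus a h \<noteq> 0 \<longrightarrow>
           (\<forall>K J. solves_K_system R a \<zeta> K \<longrightarrow>
              (solves_J_system R a h \<zeta> \<theta> \<psi>t \<pi> K J \<longleftrightarrow>
                 (\<forall>t\<in>{0..R}. \<forall>i\<in>{1,2}.
                    J t i = J_formula R a h \<zeta> (g_fun a h \<theta> \<psi>t \<pi> K) t i))))"
proof -
  have T: "{0..R} \<subseteq> {0..T}" using horizon by auto
  have a_neg: "a i i \<le> 0" if "i \<in> {1,2}" for i
    using historical(1) that unfolding is_generator_def by force
  have h: "0 < h i" if "i \<in> {1,2}" for i using coefficients[OF that] by simp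
  have other: "3 - i \<in> {1,2}" if "i \<in> {1,2}" for i :: nat using that by auto
  have \<psi>_pos: "0 < \<psi> t i" if "t \<in> {0..R}" "i \<in> {1,2}" for t i
    unfolding \<psi> using bond_price_pos[OF pricing _ that(2)] that(1) T by blast
  have \<psi>_cont: "continuous_on {0..R} (\<lambda>t. \<psi> t i)" if "i \<in> {1,2}" for i
    unfolding \<psi> using bond_price_continuous[OF pricing that aQ_cont] T by (rule continuous_on_subset)
  \<comment> \<open>Unique existence makes the definite description satisfy its equation.\<close>
  have \<pi>_root: "\<pi> t i < 1 \<and> 0 < 1 + \<pi> t i * \<psi>t t i \<and> foc (\<theta> t i) (h i) (a i i) (\<psi>t t i) (\<pi> t i) = 0"
    if "t \<in> {0..R}" "i \<in> {1,2}" for t i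
    using theI'[OF fraction_exists[OF that]]
      bond_fraction_eq_iff[where \<psi> = \<psi>, OF \<psi>_pos[OF that] \<psi>_pos[OF that(1) other[OF that(2)]]]
    unfolding \<pi>[symmetric] \<psi>t[symmetric] by blast
  have \<psi>t_cont: "continuous_on {0..R} (\<lambda>t. \<psi>t t i)" if i: "i \<in> {1,2}" for i
    unfolding \<psi>t using \<psi>_pos[OF _ i]
    by (intro continuous_intros \<psi>_cont i other) (auto simp: less_le)
  have \<theta>_cont: "continuous_on {0..R} (\<lambda>t. \<theta> t i)" if i: "i \<in> {1,2}" for i
    unfolding \<theta> \<psi>t[symmetric]
    by (intro continuous_intros \<psi>t_cont i continuous_on_subset[OF aQ_cont T] other)
  have \<pi>_cont: "continuous_on {0..R} (\<lambda>t. \<pi> t i)" if i: "i \<in> {1,2}" for i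
    by (rule foc_root_continuous[OF h[OF i] a_neg[OF i] \<theta>_cont[OF i] \<psi>t_cont[OF i] \<pi>_root[OF _ i]])
  \<comment> \<open>\<open>K\<close> is continuous as a differentiable function, and
    \<open>\<pi>_root\<close> keeps the arguments of both logarithms positive.\<close>
  have g_cont: "continuous_on {0..R} (\<lambda>t. g_fun a h \<theta> \<psi>t \<pi> K t i)"
    if K: "solves_K_system R a \<zeta> K" and i: "i \<in> {1,2}" for K i
  proof -
    have "continuous_on {0..R} (\<lambda>t. K t i)"
      using K i unfolding solves_K_system_alt
      by (intro DERIV_continuous_on[where D = "\<lambda>t. - a i i * K t i + a i i * K t (3 - i) - \<zeta> i"]) blast
    then show ?thesis
      unfolding g_fun_def using \<pi>_root[OF _ i]
      by (intro continuous_intros \<pi>_cont \<psi>t_cont \<theta>_cont i) (auto simp: less_le)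
  qed
  \<comment> \<open>A square plus four times a product of two nonpositive numbers; being nonzero
    therefore means being positive, as \<open>J_formula_iff\<close> requires.\<close>
  have "0 \<le> c_plus a h"
    unfolding c_plus_def using a_neg[of 1] a_neg[of 2] by (simp add: mult_nonpos_nonpos)
  then have J: "solves_J_system R a h \<zeta> \<theta> \<psi>t \<pi> K J \<longleftrightarrow>
       (\<forall>t\<in>{0..R}. \<forall>i\<in>{1,2}. J t i = J_formula R a h \<zeta> (g_fun a h \<theta> \<psi>t \<pi> K) t i)"
    if "c_plus a h \<noteq> 0" "solves_K_system R a \<zeta> K" for K J
    using J_formula_iff[OF horizon(1) _ g_cont[OF that(2)]] that(1) by simp
  have fraction: "\<pi> t i = (if \<theta> t i = 0 then - ((h i + a i i * \<psi>t t i) / ((h i - a i i) * \<psi>t t i))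
       else ((a i i - h i) * \<psi>t t i + \<theta> t i * (\<psi>t t i - 1) + sqrt (Delta a h \<theta> \<psi>t t i))
              / (2 * \<theta> t i * \<psi>t t i))"
    if "t \<in> {0..R}" "i \<in> {1,2}" "\<psi>t t i \<noteq> 0" for t i
    unfolding Delta_def using foc_root[OF h a_neg that(3)] \<pi>_root that by blast
  show ?thesis
    by (intro conjI impI allI ballI) (fact K_formula_iff[OF horizon(1)] fraction J)+
qed

end
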